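(* For all integers $n\geq 0$, \[ B_{2,15}(9n+8)\equiv 0\pmod{5},\qquad B_{2,15}(27n+14)\equiv 0\pmod{5},\qquad B_{2,15}(27n+23)\equiv 2B_{2,15}(3n+2)\pmod{5}. \]
   Context: For integers $s,t>1$, an $(s,t)$-regular bipartition of $n$ is a pair $(\lambda,\mu)$ of partitions with total sum of parts $n$ such that no part of $\lambda$ is divisible by $s$ and no part of $\mu$ is divisible by $t$. $B_{s,t}(n)$ denotes the number of $(s,t)$-regular bipartitions of $n$; equivalently $\sum_{n\geq0}B_{s,t}(n)q^n=\frac{f_sf_t}{f_1^2}$, where $f_k=\prod_{m\geq1}(1-q^{mk})$. *)

theory Defs
  imports "HOL-Number_Theory.Cong" "HOL-Library.Multiset"
begin

text \<open>A partition is the finite multiset of its parts, which are positive integers.\<close>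

definition regular_partition :: "nat \<Rightarrow> nat multiset \<Rightarrow> bool" where
  "regular_partition s lam \<longleftrightarrow> (\<forall>p\<in>#lam. p > 0 \<and> \<not> s dvd p)"

definition regular_bipartitions :: "nat \<Rightarrow> nat \<Rightarrow> nat \<Rightarrow> (nat multiset \<times> nat multiset) set" where
  "regular_bipartitions s t n =
     {(lam, mu). regular_partition s lam \<and> regular_partition t mu \<and>
                 sum_mset lam + sum_mset mu = n}"

text \<open>The number $B_{s,t}(n)$; the finiteness shown below makes \<open>card\<close> the true count.\<close>

definition B :: "nat \<Rightarrow> nat \<Rightarrow> nat \<Rightarrow> nat" where
  "B s t n = card (regular_bipartitions s t n)"

lemma finite_positive_msets_sum_le:
  "finite {M :: nat multiset. (\<forall>p\<in>#M. p > 0) \<and> sum_mset M \<le> n}"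
proof -
  have "size M \<le> sum_mset M" if "\<forall>p\<in>#M. p > 0" for M :: "nat multiset"
    using that by (induction M) (auto simp: Suc_le_eq)
  moreover have "p \<le> sum_mset M" if "p \<in># M" for p and M :: "nat multiset"
    using that by (metis le_add1 multi_member_split sum_mset.add_mset)
  ultimately have "{M :: nat multiset. (\<forall>p\<in>#M. p > 0) \<and> sum_mset M \<le> n}
      \<subseteq> mset ` {xs. set xs \<subseteq> {..n} \<and> length xs \<le> n}"
  proof (intro subsetI)
    fix M :: "nat multiset"
    assume sz: "\<And>M :: nat multiset. \<forall>p\<in>#M. p > 0 \<Longrightarrow> size M \<le> sum_mset M"
      and mem: "\<And>p (M :: nat multiset). p \<in># M \<Longrightarrow> p \<le> sum_mset M"
      and M: "M \<in> {M. (\<forall>p\<in>#M. p > 0) \<and> sum_mset M \<le> n}"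
    obtain xs where xs: "mset xs = M" using ex_mset by blast
    have "set xs \<subseteq> {..n}"
    proof
      fix p assume "p \<in> set xs"
      then have "p \<in># M" using xs by auto
      then have "p \<le> sum_mset M" by (rule mem)
      then show "p \<in> {..n}" using M by simp
    qed
    moreover have "length xs \<le> n"
      using sz[of M] M xs size_mset[of xs] by simp
    ultimately show "M \<in> mset ` {xs. set xs \<subseteq> {..n} \<and> length xs \<le> n}"
      using xs by blast
  qed
  then show ?thesis
    by (rule finite_subset) (simp add: finite_lists_length_le)
qed

lemma finite_regular_bipartitions: "finite (regular_bipartitions s t n)"
proof (rule finite_subset)
  show "regular_bipartitions s t n \<subseteq>
      {M. (\<forall>p\<in>#M. p > 0) \<and> sum_mset M \<le> n} \<times> {M. (\<forall>p\<in>#M. p > 0) \<and> sum_mset M \<le> n}"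
    by (auto simp: regular_bipartitions_def regular_partition_def)
  show "finite ({M :: nat multiset. (\<forall>p\<in>#M. p > 0) \<and> sum_mset M \<le> n} \<times>
      {M :: nat multiset. (\<forall>p\<in>#M. p > 0) \<and> sum_mset M \<le> n})"
    by (intro finite_cartesian_product finite_positive_msets_sum_le)
qed

end

theory Submission
  imports Defs Complex_Main "HOL-Computational_Algebra.Formal_Power_Series"
    "HOL-Computational_Algebra.Polynomial"
begin

text \<open>
  Write \<open>B(n)\<close> for \<open>B 2 15 n\<close> and \<open>G = \<Sum>n. B(n) q\<^sup>n\<close>. Since \<open>f\<^sub>1\<^sup>2 / f\<^sub>2 = \<phi>(-q)\<close>, we have
  \<open>G \<phi>(-q) = f\<^bsub>15\<^esub>\<close>, a series in \<open>q\<^sup>3\<close>. The 3-dissection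
  \<open>\<phi>(-q) = \<phi>(-q\<^sup>9) - 2 q \<Omega>(-q\<^sup>3)\<close> and the norm of \<open>\<phi>(-q)\<close> over the cube roots of unity give
  \<open>\<Sum>n. B(3n+2) q\<^sup>n = 4 f\<^sub>2\<^sup>2 f\<^sub>5 f\<^sub>6\<^sup>3 / f\<^sub>1\<^sup>6\<close>.

  Modulo 5 we have \<open>f\<^sub>5 = f\<^sub>1\<^sup>5\<close>, so this becomes \<open>4 \<psi>(q) f\<^sub>6\<^sup>3\<close>, where \<open>\<psi>(q) = f\<^sub>2\<^sup>2 / f\<^sub>1\<close> is the
  sum of \<open>q\<^sup>t\<close> over the triangular numbers \<open>t\<close>. These avoid the residue 2 modulo 3, which is the
  first congruence, and those of residue 1 contribute \<open>q \<psi>(q\<^sup>9)\<close>, so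
  \<open>\<Sum>n. B(9n+5) q\<^sup>n = 4 \<psi>(q\<^sup>3) f\<^sub>2\<^sup>3\<close>. By Jacobi's formula the exponents of \<open>f\<^sub>2\<^sup>3\<close> are the
  \<open>k (k + 1)\<close>: none has residue 1, which is the second congruence, and those of residue 2
  contribute \<open>-3\<close> times \<open>q\<^sup>2\<close> times the cube of \<open>f\<^bsub>18\<^esub>\<close>. This reproduces the series \<open>4 \<psi>(q) f\<^sub>6\<^sup>3\<close>
  up to the factor \<open>-3\<close>, which is the third congruence.
\<close>

unbundle fps_syntax

text \<open>Allows \<open>q\<close> to be a power series in the cube formula below, whose proof
  compares polynomials by their values and so works over a domain of characteristic 0.\<close>

instance fps :: (ring_char_0) ring_char_0 ..

section \<open>Infinite products of formal power series\<close>

text \<open>Congruence modulo \<open>fps_X ^ N\<close>. It stands in for convergence: an identity of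
  infinite products is checked modulo every power of \<open>fps_X\<close>, where only finite
  products occur.\<close>

definition fps_cong :: "nat \<Rightarrow> 'a::comm_ring_1 fps \<Rightarrow> 'a fps \<Rightarrow> bool" where
  "fps_cong N f g \<longleftrightarrow> (\<forall>k<N. f $ k = g $ k)"

lemma fps_cong_refl [simp]: "fps_cong N f f"
  by (simp add: fps_cong_def)

lemma fps_cong_sym: "fps_cong N f g \<Longrightarrow> fps_cong N g f"
  by (simp add: fps_cong_def)

lemma fps_cong_trans [trans]: "fps_cong N f g \<Longrightarrow> fps_cong N g h \<Longrightarrow> fps_cong N f h"
  by (simp add: fps_cong_def)

lemma fps_cong_mono: "fps_cong N f g \<Longrightarrow> M \<le> N \<Longrightarrow> fps_cong M f g"
  by (simp add: fps_cong_def)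

lemma fps_cong_mult: "fps_cong N f g \<Longrightarrow> fps_cong N f' g' \<Longrightarrow> fps_cong N (f * f') (g * g')"
  by (auto simp: fps_cong_def fps_mult_nth intro!: sum.cong)

lemma fps_cong_mult_left: "fps_cong N f g \<Longrightarrow> fps_cong N (h * f) (h * g)"
  by (rule fps_cong_mult) auto

lemma fps_cong_sum:
  "(\<And>i. i \<in> A \<Longrightarrow> fps_cong N (f i) (g i)) \<Longrightarrow> fps_cong N (\<Sum>i\<in>A. f i) (\<Sum>i\<in>A. g i)"
  by (simp add: fps_cong_def fps_sum_nth)

lemma fps_cong_prod:
  assumes "\<And>i. i \<in> A \<Longrightarrow> fps_cong N (f i) (g i)"
  shows "fps_cong N (\<Prod>i\<in>A. f i) (\<Prod>i\<in>A. g i)"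
  using assms by (induction A rule: infinite_finite_induct) (auto intro: fps_cong_mult)

lemma fps_eq_cong_iff: "f = g \<longleftrightarrow> (\<forall>N. fps_cong N f g)"
  by (auto simp: fps_cong_def fps_eq_iff)

lemma fps_cong_X_power_mult:
  assumes "N \<le> k"
  shows "fps_cong N (f * fps_X ^ k) 0"
  using assms by (simp add: fps_cong_def fps_X_power_mult_right_nth)

lemma fps_unit_exists_inverse:
  fixes f :: "'a::comm_ring_1 fps"
  assumes "f $ 0 = 1"
  obtains g where "f * g = 1"
  using fps_right_inverse[of f 1] assms by auto

lemma fps_cong_mult_cancel:
  assumes "fps_cong N (f * g) (f * h)" "f $ 0 = 1"
  shows "fps_cong N g h"
proof -
  obtain f' where f': "f * f' = 1"
    using fps_unit_exists_inverse assms(2) by blast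
  have "fps_cong N (f' * (f * g)) (f' * (f * h))"
    using assms(1) by (rule fps_cong_mult_left)
  moreover have "f' * (f * g) = g" "f' * (f * h) = h"
    using f' by (simp_all add: mult.assoc[symmetric] mult.commute)
  ultimately show ?thesis by simp
qed

text \<open>The product \<open>\<Prod>i. g i\<close>; meaningful when \<open>g i\<close> agrees with 1 up to \<open>X\<^sup>i\<close>, so that the
  coefficient of \<open>X\<^sup>n\<close> is not affected by the factors from \<open>g n\<close> on.\<close>

definition fps_infprod :: "(nat \<Rightarrow> 'a::comm_ring_1 fps) \<Rightarrow> 'a fps" where
  "fps_infprod g = Abs_fps (\<lambda>n. (\<Prod>i<n. g i) $ n)"

definition infprod_ok :: "(nat \<Rightarrow> 'a::comm_ring_1 fps) \<Rightarrow> bool" where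
  "infprod_ok g \<longleftrightarrow> (\<forall>i. fps_cong (Suc i) (g i) 1)"

lemma infprod_okI: "(\<And>i. fps_cong (Suc i) (g i) 1) \<Longrightarrow> infprod_ok g"
  by (simp add: infprod_ok_def)

lemma infprod_ok_mult [intro]:
  "infprod_ok g \<Longrightarrow> infprod_ok h \<Longrightarrow> infprod_ok (\<lambda>i. g i * h i)"
  unfolding infprod_ok_def by (metis fps_cong_mult mult_1)

lemma infprod_ok_prod_atLeast:
  assumes "infprod_ok g"
  shows "fps_cong (Suc N) (\<Prod>i\<in>{N..<M}. g i) 1"
proof -
  have "fps_cong (Suc N) (\<Prod>i\<in>{N..<M}. g i) (\<Prod>i\<in>{N..<M}. 1)"
    by (rule fps_cong_prod)
       (use assms in \<open>auto simp: infprod_ok_def intro: fps_cong_mono\<close>)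
  then show ?thesis by simp
qed

lemma infprod_ok_prod_cong:
  assumes "infprod_ok g" "N \<le> M"
  shows "fps_cong (Suc N) (\<Prod>i<M. g i) (\<Prod>i<N. g i)"
proof -
  have "(\<Prod>i<M. g i) = (\<Prod>i<N. g i) * (\<Prod>i\<in>{N..<M}. g i)"
    using assms(2) by (metis atLeast0LessThan le0 prod.atLeastLessThan_concat)
  also have "fps_cong (Suc N) \<dots> ((\<Prod>i<N. g i) * 1)"
    using assms(1) by (intro fps_cong_mult_left infprod_ok_prod_atLeast)
  finally show ?thesis by simp
qed

lemma fps_infprod_cong:
  assumes "infprod_ok g" "N \<le> M"
  shows "fps_cong (Suc N) (fps_infprod g) (\<Prod>i<M. g i)"
  unfolding fps_cong_def
proof (intro allI impI)
  fix k assume k: "k < Suc N"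
  then have "fps_cong (Suc k) (\<Prod>i<M. g i) (\<Prod>i<k. g i)"
    using assms by (intro infprod_ok_prod_cong) auto
  then show "fps_infprod g $ k = (\<Prod>i<M. g i) $ k"
    by (simp add: fps_infprod_def fps_cong_def)
qed

lemma fps_infprod_eqI:
  assumes "infprod_ok g" "\<And>N. \<exists>M\<ge>N. fps_cong (Suc N) f (\<Prod>i<M. g i)"
  shows "f = fps_infprod g"
  unfolding fps_eq_cong_iff
proof
  fix N
  obtain M where "M \<ge> N" "fps_cong (Suc N) f (\<Prod>i<M. g i)"
    using assms(2) by blast
  moreover from this have "fps_cong (Suc N) (\<Prod>i<M. g i) (fps_infprod g)"
    using assms(1) fps_cong_sym fps_infprod_cong by blast
  ultimately have "fps_cong (Suc N) f (fps_infprod g)"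
    using fps_cong_trans by blast
  then show "fps_cong N f (fps_infprod g)"
    by (rule fps_cong_mono) simp
qed

lemma fps_infprod_mult:
  assumes "infprod_ok g" "infprod_ok h"
  shows "fps_infprod (\<lambda>i. g i * h i) = fps_infprod g * fps_infprod h"
proof (rule sym, rule fps_infprod_eqI)
  show "\<exists>M\<ge>N. fps_cong (Suc N) (fps_infprod g * fps_infprod h) (\<Prod>i<M. g i * h i)" for N
    using fps_cong_mult[OF fps_infprod_cong[OF assms(1), of N N] fps_infprod_cong[OF assms(2), of N
        N]]
    by (auto simp: prod.distrib)
qed (use assms in auto)

lemma fps_infprod_one [simp]: "fps_infprod (\<lambda>_. 1) = 1"
  by (simp add: fps_infprod_def fps_eq_iff)

lemma infprod_ok_one [simp]: "infprod_ok (\<lambda>_. 1)"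
  by (simp add: infprod_ok_def)

lemma infprod_ok_power: "infprod_ok g \<Longrightarrow> infprod_ok (\<lambda>i. g i ^ n)"
  by (induction n) auto

lemma fps_infprod_power:
  "infprod_ok g \<Longrightarrow> fps_infprod (\<lambda>i. g i ^ n) = fps_infprod g ^ n"
  by (induction n) (auto simp: fps_infprod_mult infprod_ok_power)

lemma infprod_ok_group:
  assumes "infprod_ok g" "d > 0"
  shows "infprod_ok (\<lambda>i. \<Prod>r<d. g (i * d + r))"
proof (rule infprod_okI)
  fix i
  have "fps_cong (Suc i) (\<Prod>r<d. g (i * d + r)) (\<Prod>r<d. 1)"
  proof (rule fps_cong_prod)
    fix r
    have "i \<le> i * d + r" using assms(2) by (simp add: trans_le_add1)
    then show "fps_cong (Suc i) (g (i * d + r)) 1"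
      using assms(1) unfolding infprod_ok_def by (meson Suc_le_mono fps_cong_mono)
  qed
  then show "fps_cong (Suc i) (\<Prod>r<d. g (i * d + r)) 1" by simp
qed

text \<open>The first \<open>N\<close> blocks together contain exactly the first
  \<open>N * d\<close> factors, and \<open>N * d \<ge> N\<close>.\<close>

lemma fps_infprod_group:
  assumes "infprod_ok g" "d > 0"
  shows "fps_infprod g = fps_infprod (\<lambda>i. \<Prod>r<d. g (i * d + r))"
proof (rule fps_infprod_eqI)
  show "infprod_ok (\<lambda>i. \<Prod>r<d. g (i * d + r))"
    by (rule infprod_ok_group) fact+
  fix N
  have "(\<Prod>i<N. \<Prod>r<d. g (i * d + r)) = (\<Prod>i<N * d. g i)"
  proof -
    have "(\<Prod>r<d. g (i * d + r)) = prod g {i * d..<i * d + d}" for i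
      using prod.shift_bounds_nat_ivl[of g 0 "i * d" d]
      by (simp add: atLeast0LessThan add.commute)
    then show ?thesis by (simp add: prod.nat_group)
  qed
  moreover have "fps_cong (Suc N) (fps_infprod g) (\<Prod>i<N * d. g i)"
    using assms by (intro fps_infprod_cong) auto
  ultimately show "\<exists>M\<ge>N. fps_cong (Suc N) (fps_infprod g) (\<Prod>i<M. \<Prod>r<d. g (i * d + r))"
    by auto
qed

text \<open>Group the right-hand product into blocks of \<open>d\<close> factors. As the numbering
  \<open>Suc i\<close> starts at 1, the only multiple of \<open>d\<close> in a block is at its last
  position \<open>r = d - 1\<close>; the other factors of the block are 1.\<close>

lemma fps_infprod_multiples:
  assumes "infprod_ok (\<lambda>i. g (Suc i))" "d > 0"
  shows "fps_infprod (\<lambda>i. g (d * Suc i)) = fps_infprod (\<lambda>i. if d dvd Suc i then g (Suc i) else 1)"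
proof -
  let ?h = "\<lambda>i. if d dvd Suc i then g (Suc i) else 1"
  have ok: "infprod_ok ?h"
    using assms(1) by (auto simp: infprod_ok_def)
  have "(\<Prod>r<d. ?h (i * d + r)) = g (d * Suc i)" for i
  proof -
    have *: "d dvd Suc (i * d + r) \<longleftrightarrow> r = d - 1" if "r < d" for r
    proof -
      have "d dvd Suc (i * d + r) \<longleftrightarrow> d dvd Suc r"
        by (metis add_Suc_right dvd_add_right_iff dvd_triv_right)
      also have "\<dots> \<longleftrightarrow> Suc r = d"
        using that by (auto dest: dvd_imp_le)
      finally show ?thesis using that by auto
    qed
    have "(\<Prod>r<d. ?h (i * d + r)) = (\<Prod>r<d. if r = d - 1 then g (d * Suc i) else 1)"
      by (rule prod.cong) (use * assms(2) in \<open>auto simp: algebra_simps\<close>)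
    then show ?thesis using assms(2) by (simp add: prod.delta)
  qed
  then show ?thesis
    using fps_infprod_group[OF ok assms(2)] by simp
qed

lemma infprod_ok_nth_0: "infprod_ok g \<Longrightarrow> fps_infprod g $ 0 = 1"
  by (simp add: fps_infprod_def)

lemma fps_cong_one_plus_X_power:
  "N \<le> k \<Longrightarrow> fps_cong N (1 + fps_const c * fps_X ^ k) 1"
  by (auto simp: fps_cong_def)

section \<open>The finite Jacobi triple product\<close>

text \<open>The Gaussian binomial coefficient. The Pascal recurrence replaces the usual quotient, so
  that it makes sense in every commutative ring.\<close>

fun qbinomial :: "'a::comm_ring_1 \<Rightarrow> nat \<Rightarrow> nat \<Rightarrow> 'a" where
  "qbinomial q n 0 = 1"
| "qbinomial q 0 (Suc k) = 0"
| "qbinomial q (Suc n) (Suc k) = qbinomial q n k + q ^ Suc k * qbinomial q n (Suc k)"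

text \<open>The q-Pochhammer symbol \<open>(q; q)_n\<close>, a q-factorial without the denominators
  \<open>1 - q\<close>.\<close>

definition qfact :: "'a::comm_ring_1 \<Rightarrow> nat \<Rightarrow> 'a" where
  "qfact q n = (\<Prod>i<n. 1 - q ^ Suc i)"

lemma qfact_0 [simp]: "qfact q 0 = 1"
  by (simp add: qfact_def)

lemma qfact_Suc: "qfact q (Suc n) = qfact q n * (1 - q ^ Suc n)"
  by (simp add: qfact_def)

lemma qbinomial_eq_0: "n < k \<Longrightarrow> qbinomial q n k = 0"
  by (induction q n k rule: qbinomial.induct) auto

lemma qbinomial_self [simp]: "qbinomial q n n = 1"
  by (induction n) (auto simp: qbinomial_eq_0)

text \<open>Division-free quotient formula. The two terms of the Pascal recurrence combine through
  \<open>(1 - q ^ Suc k) + q ^ Suc k * (1 - q ^ (n - k)) = 1 - q ^ Suc n\<close>.\<close>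

lemma qbinomial_mult_qfact:
  "k \<le> n \<Longrightarrow> qbinomial q n k * (qfact q k * qfact q (n - k)) = qfact q n"
proof (induction q n k rule: qbinomial.induct)
  case (3 q n k)
  show ?case
  \<comment> \<open>The second induction hypothesis needs \<open>Suc k \<le> n\<close>, hence the
    separate case.\<close>
  proof (cases "k = n")
    case True
    then show ?thesis by (simp add: qbinomial_eq_0)
  next
    case False
    with 3 have k: "k < n" by simp
    define A where "A = qbinomial q n k"
    define A' where "A' = qbinomial q n (Suc k)"
    define F where "F = qfact q k"
    define G where "G = qfact q (n - Suc k)"
    have nk: "n - k = Suc (n - Suc k)" using k by simp
    have IH1: "A * (F * (G * (1 - q ^ (n - k)))) = qfact q n"
    proof -
      have "qfact q (n - k) = G * (1 - q ^ (n - k))"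
        unfolding G_def nk by (simp add: qfact_Suc)
      then show ?thesis using "3.IH"(1) k by (simp add: A_def F_def)
    qed
    have IH2: "A' * ((F * (1 - q ^ Suc k)) * G) = qfact q n"
      using "3.IH"(2) k unfolding A'_def F_def G_def by (simp add: qfact_Suc)
    have pw: "q ^ Suc k * q ^ (n - k) = q ^ Suc n"
      using k by (simp only: power_add[symmetric]) simp
    have "qbinomial q (Suc n) (Suc k) * (qfact q (Suc k) * qfact q (Suc n - Suc k))
        = (A + q ^ Suc k * A') * ((F * (1 - q ^ Suc k)) * (G * (1 - q ^ (n - k))))"
      unfolding A_def A'_def F_def G_def by (simp add: qfact_Suc nk)
    also have "\<dots> = (A * (F * (G * (1 - q ^ (n - k))))) * (1 - q ^ Suc k)
        + q ^ Suc k * (1 - q ^ (n - k)) * (A' * ((F * (1 - q ^ Suc k)) * G))"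
      by (simp only: algebra_simps)
    also have "\<dots> = qfact q n * ((1 - q ^ Suc k) + q ^ Suc k * (1 - q ^ (n - k)))"
      unfolding IH1 IH2 by (simp only: algebra_simps)
    also have "(1 - q ^ Suc k) + q ^ Suc k * (1 - q ^ (n - k)) = 1 - q ^ Suc n"
      unfolding pw[symmetric] by (simp only: algebra_simps) simp
    finally show ?thesis by (simp only: qfact_Suc)
  qed
qed auto

theorem q_binomial_theorem:
  fixes x y q :: "'a::comm_ring_1"
  shows "(\<Prod>i<n. x + y * q ^ i) =
    (\<Sum>k\<le>n. q ^ (k choose 2) * qbinomial q n k * y ^ k * x ^ (n - k))"
proof (induction n arbitrary: y)
  case (Suc n)
  let ?t = "\<lambda>n k. q ^ (k choose 2) * qbinomial q n k * y ^ k * x ^ (n - k)"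
  have ch: "Suc k choose 2 = (k choose 2) + k" for k
    by (simp add: numeral_2_eq_2)
  \<comment> \<open>Splitting off the factor with \<open>i = 0\<close> leaves the same product for
    \<open>y * q\<close>; this is why \<open>y\<close> is arbitrary in the induction.\<close>
  have "(\<Prod>i<Suc n. x + y * q ^ i) = (x + y) * (\<Prod>i<n. x + (y * q) * q ^ i)"
    by (simp add: prod.lessThan_Suc_shift mult.assoc del: prod.lessThan_Suc)
  also have "\<dots> = (x + y) * (\<Sum>k\<le>n. q ^ k * ?t n k)"
    unfolding Suc.IH by (simp add: power_mult_distrib mult_ac)
  also have "\<dots> = (\<Sum>k\<le>n. q ^ k * ?t n k * x) + (\<Sum>k\<le>n. q ^ k * ?t n k * y)"
    unfolding distrib_right sum_distrib_left by (simp add: mult_ac sum.distrib)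
  also have "(\<Sum>k\<le>n. q ^ k * ?t n k * x) = (\<Sum>k\<le>Suc n. q ^ k * q ^
      (k choose 2) * qbinomial q n k * y ^ k * x ^ (Suc n - k))"
    by (simp add: qbinomial_eq_0) (rule sum.cong, auto simp: Suc_diff_le mult_ac)
  also have "\<dots> = x ^ Suc n + (\<Sum>k\<le>n. q ^ Suc k * q ^ (Suc k choose 2) * qbinomial q n
      (Suc k) * y ^ Suc k * x ^ (n - k))"
    by (subst sum.atMost_Suc_shift) (simp add: numeral_2_eq_2)
  also have "\<dots> + (\<Sum>k\<le>n. q ^ k * ?t n k * y)
     = x ^ Suc n + (\<Sum>k\<le>n. ?t (Suc n) (Suc k))"
    by (simp add: ch algebra_simps power_add flip: sum.distrib)
  also have "\<dots> = (\<Sum>k\<le>Suc n. ?t (Suc n) k)"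
    by (subst sum.atMost_Suc_shift) (simp add: numeral_2_eq_2)
  finally show ?case .
qed (simp add: numeral_2_eq_2)

text \<open>The exponent of \<open>q\<close> in the triple product, a triangular number also for
  negative \<open>j\<close>: \<open>tri (1 - j) = tri j\<close>.\<close>

definition tri :: "int \<Rightarrow> nat" where
  "tri j = nat (j * (j - 1) div 2)"

lemma tri_times_2: "2 * int (tri j) = j * (j - 1)"
proof -
  have "even (j * (j - 1))" by auto
  moreover have "0 \<le> j * (j - 1)"
    by (cases "j \<ge> 1") (auto simp: mult_nonpos_nonpos)
  ultimately show ?thesis by (simp add: tri_def)
qed

lemma choose_2_times_2: "2 * int (k choose 2) = int k * (int k - 1)"
  by (induction k) (simp_all add: numeral_2_eq_2 algebra_simps)

lemma prod_nat_power: "(\<Prod>i<n. q ^ i) = (q::'a::comm_semiring_1) ^ (n choose 2)"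
  by (induction n) (simp_all add: numeral_2_eq_2 power_add mult_ac)

text \<open>The q-binomial theorem for \<open>2 * n\<close> factors with \<open>x = q ^ n\<close>.
  The first \<open>n\<close> factors are \<open>q ^ i * (z + q ^ (n - i))\<close>, the others
  \<open>q ^ n * (1 + z * q ^ i)\<close>; the common power of \<open>q\<close> is then cancelled,
  which uses \<open>q \<noteq> 0\<close>.\<close>

theorem finite_jacobi_triple_product:
  fixes q z :: "'a::idom"
  assumes "q \<noteq> 0"
  shows "(\<Prod>i<n. z + q ^ Suc i) * (\<Prod>i<n. 1 + z * q ^ i) =
    (\<Sum>k\<le>2*n. qbinomial q (2 * n) k * q ^ tri (int k - int n) * z ^ k)"
proof -
  \<comment> \<open>The total power of \<open>q\<close> pulled out:
    \<open>0 + 1 + ... + (n - 1)\<close> from the first half, \<open>n\<close> from each of the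
    \<open>n\<close> factors of the second.\<close>
  define e where "e = (n choose 2) + n * n"
  have "(\<Prod>i<2*n. q ^ n + z * q ^ i) = (\<Prod>i<n. q ^ n + z * q ^ i) * (\<Prod>i<n. q ^ n + z * q ^ (n + i))"
    using prod.atLeastLessThan_concat[of 0 n "2*n" "\<lambda>i. q ^ n + z * q ^ i"]
      prod.shift_bounds_nat_ivl[of "\<lambda>i. q ^ n + z * q ^ i" 0 n n]
    by (simp add: atLeast0LessThan add.commute mult_2)
  also have "(\<Prod>i<n. q ^ n + z * q ^ i) = (\<Prod>i<n. q ^ i * (z + q ^ (n - i)))"
    by (rule prod.cong) (auto simp: algebra_simps simp flip: power_add)
  also have "\<dots> = q ^ (n choose 2) * (\<Prod>i<n. z + q ^ (n - i))"
    by (simp add: prod.distrib prod_nat_power)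
  also have "(\<Prod>i<n. z + q ^ (n - i)) = (\<Prod>i<n. z + q ^ Suc i)"
    by (subst prod.nat_diff_reindex[symmetric]) (auto intro!: prod.cong simp: Suc_diff_Suc)
  also have "(\<Prod>i<n. q ^ n + z * q ^ (n + i)) = (\<Prod>i<n. q ^ n * (1 + z * q ^ i))"
    by (rule prod.cong) (auto simp: algebra_simps power_add)
  also have "\<dots> = q ^ (n * n) * (\<Prod>i<n. 1 + z * q ^ i)"
    by (simp add: prod.distrib power_mult)
  finally have L: "(\<Prod>i<2*n. q ^ n + z * q ^ i) =
      q ^ e * ((\<Prod>i<n. z + q ^ Suc i) * (\<Prod>i<n. 1 + z * q ^ i))"
    by (simp add: e_def power_add mult_ac)
  have "(\<Prod>i<2*n. q ^ n + z * q ^ i) =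
     (\<Sum>k\<le>2*n. q ^ (k choose 2) * qbinomial q (2*n) k * z ^ k * (q ^ n) ^ (2*n - k))"
    by (rule q_binomial_theorem)
  also have "\<dots> = (\<Sum>k\<le>2*n. q ^ e * (qbinomial q (2*n) k * q ^ tri (int k - int n) * z ^ k))"
  proof (rule sum.cong)
    fix k assume "k \<in> {..2*n}"
    then have k: "k \<le> 2 * n" by simp
    define m where "m = 2 * n - k"
    have m: "int m = 2 * int n - int k" using k by (simp add: m_def)
    \<comment> \<open>The exponents are compared after doubling, which clears the halves in
      \<open>choose\<close> and \<open>tri\<close>.\<close>
    have "2 * int ((k choose 2) + n * m) = 2 * int (e + tri (int k - int n))"
      using choose_2_times_2[of k] choose_2_times_2[of n] tri_times_2[of "int k - int n"]
      by (simp add: e_def m algebra_simps)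
    then have "int ((k choose 2) + n * (2 * n - k)) = int (e + tri (int k - int n))"
      by (simp add: m_def)
    then have ex: "(k choose 2) + n * (2 * n - k) = e + tri (int k - int n)"
      by (simp only: of_nat_eq_iff)
    have "q ^ (k choose 2) * (q ^ n) ^ (2*n - k) = q ^ e * q ^ tri (int k - int n)"
      using ex by (metis power_add power_mult)
    then show "q ^ (k choose 2) * qbinomial q (2*n) k * z ^ k * (q ^ n) ^ (2*n - k)
       = q ^ e * (qbinomial q (2*n) k * q ^ tri (int k - int n) * z ^ k)"
      by (simp add: mult_ac)
  qed simp
  finally have "q ^ e * ((\<Prod>i<n. z + q ^ Suc i) * (\<Prod>i<n. 1 + z * q ^ i)) =
     q ^ e * (\<Sum>k\<le>2*n. qbinomial q (2*n) k * q ^ tri (int k - int n) * z ^ k)"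
    unfolding L by (simp add: sum_distrib_left)
  then show ?thesis using assms by simp
qed

lemma sum_atMost_shift_int:
  "(\<Sum>k\<le>2*n. f (int k - int n)) = (\<Sum>j\<in>{-int n..int n}. f j)"
  by (rule sum.reindex_bij_witness[of _ "\<lambda>j. nat (j + int n)" "\<lambda>k. int k - int n"]) auto

section \<open>The triple product and Jacobi's cube as power series\<close>

text \<open>\<open>qprod m\<close> is \<open>f\<^sub>m\<close> in the notation of the paper.\<close>

definition qprod :: "nat \<Rightarrow> 'a::comm_ring_1 fps" where
  "qprod m = fps_infprod (\<lambda>i. 1 - fps_X ^ (m * Suc i))"

text \<open>In Pochhammer notation with \<open>q = fps_X\<close>, the infinite product
  \<open>(-c q^s; q^m)\<close>.\<close>

definition aprod :: "'a::comm_ring_1 \<Rightarrow> nat \<Rightarrow> nat \<Rightarrow> 'a fps" where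
  "aprod c m s = fps_infprod (\<lambda>i. 1 + fps_const c * fps_X ^ (m * i + s))"

lemma infprod_ok_arith:
  "m > 0 \<Longrightarrow> s > 0 \<Longrightarrow> infprod_ok (\<lambda>i. 1 + fps_const c * fps_X ^ (m * i + s))"
proof (intro infprod_okI fps_cong_one_plus_X_power)
  fix i :: nat assume "m > 0" "s > 0"
  then have "i \<le> m * i" "1 \<le> s" by auto
  then show "Suc i \<le> m * i + s" by linarith
qed

lemma qprod_eq_aprod: "qprod m = aprod (-1) m m"
  by (simp add: qprod_def aprod_def add.commute fps_const_neg[symmetric] del: fps_const_neg)

lemma infprod_ok_qprod: "m > 0 \<Longrightarrow> infprod_ok (\<lambda>i. 1 - fps_X ^ (m * Suc i) :: 'a::comm_ring_1 fps)"
  using infprod_ok_arith[of m m "-1 :: 'a"]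
  by (simp add: add.commute fps_const_neg[symmetric] del: fps_const_neg)

lemma qprod_nth_0 [simp]: "m > 0 \<Longrightarrow> qprod m $ 0 = 1"
  unfolding qprod_def by (rule infprod_ok_nth_0) (rule infprod_ok_qprod)

lemma qprod_nonzero [simp]: "m > 0 \<Longrightarrow> qprod m \<noteq> (0 :: 'a::comm_ring_1 fps)"
  by (metis fps_zero_nth qprod_nth_0 zero_neq_one)

lemma qprod_cong_qfact:
  assumes "m > 0" "N \<le> k"
  shows "fps_cong (Suc N) (qprod m) (qfact (fps_X ^ m) k)"
proof -
  have "qfact (fps_X ^ m) k = (\<Prod>i<k. 1 - fps_X ^ (m * Suc i) :: 'a fps)"
    by (simp only: qfact_def power_mult)
  then show ?thesis
    unfolding qprod_def using fps_infprod_cong[OF infprod_ok_qprod[OF assms(1)] assms(2)]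
    by simp
qed

text \<open>Central Gaussian binomials tend to the reciprocal of the infinite product. In the
  quotient formula all three \<open>qfact\<close> factors are congruent to \<open>qprod m\<close>,
  and one \<open>qprod m\<close> cancels because its constant term is 1.\<close>

lemma qprod_mult_qbinomial_cong:
  assumes "m > 0" "N \<le> k" "k + N \<le> n"
  shows "fps_cong (Suc N) (qprod m * qbinomial (fps_X ^ m) n k) (1 :: 'a::comm_ring_1 fps)"
proof (rule fps_cong_mult_cancel)
  let ?Q = "qfact (fps_X ^ m :: 'a fps)"
  have "fps_cong (Suc N) (qprod m * (qprod m * qbinomial (fps_X ^ m) n k))
      (?Q k * (?Q (n - k) * qbinomial (fps_X ^ m) n k))"
    using assms by (intro fps_cong_mult qprod_cong_qfact fps_cong_refl) auto
  also have "?Q k * (?Q (n - k) * qbinomial (fps_X ^ m) n k) = ?Q n"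
    using qbinomial_mult_qfact[of k n "fps_X ^ m :: 'a fps"] assms(3) by (simp add: mult_ac)
  also have "fps_cong (Suc N) \<dots> (qprod m * 1)"
    using assms by (auto intro!: fps_cong_sym[OF qprod_cong_qfact])
  finally show "fps_cong (Suc N) (qprod m * (qprod m * qbinomial (fps_X ^ m) n k))
      (qprod m * 1 :: 'a fps)" .
qed (use assms in simp)

text \<open>The formal sum of \<open>c j * fps_X ^ e j\<close>, intended for \<open>e\<close> with
  finite fibres; an infinite fibre would contribute the default value 0.\<close>

definition theta_series :: "('i \<Rightarrow> 'a::comm_ring_1) \<Rightarrow> ('i \<Rightarrow> nat) \<Rightarrow> 'a fps" where
  "theta_series c e = Abs_fps (\<lambda>n. \<Sum>j | e j = n. c j)"

lemma theta_series_nth [simp]: "theta_series c e $ n = (\<Sum>j | e j = n. c j)"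
  by (simp add: theta_series_def)

text \<open>The limit of the finite triple product. For \<open>\<bar>j\<bar> \<le> N + 1\<close> the
  binomial is central enough for its product with \<open>qprod m\<close> to be 1 modulo
  \<open>fps_X ^ Suc N\<close>; for larger \<open>\<bar>j\<bar>\<close> the power
  \<open>fps_X ^ e j\<close> already vanishes there. The bound has \<open>Suc\<close> because
  \<open>tri 1 = 0\<close>.\<close>

lemma theta_series_cong_qbinomial_sum:
  fixes c :: "int \<Rightarrow> 'a::comm_ring_1"
  assumes "m > 0" "\<And>j. nat \<bar>j\<bar> \<le> Suc (e j)" "2 * N + 2 \<le> n"
  shows "fps_cong (Suc N)
    (qprod m * (\<Sum>j\<in>{-int n..int n}. fps_const (c j) * qbinomial (fps_X ^ m) (2 * n) (nat
        (int n + j)) * fps_X ^ e j))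
    (theta_series c e)"
proof -
  let ?b = "\<lambda>j. qbinomial (fps_X ^ m :: 'a fps) (2 * n) (nat (int n + j))"
  have "fps_cong (Suc N) (\<Sum>j\<in>{-int n..int n}. fps_const (c j) * (qprod m * ?b j) * fps_X ^ e j)
    (\<Sum>j\<in>{-int n..int n}. fps_const (c j) * 1 * fps_X ^ e j)"
  proof (rule fps_cong_sum)
    fix j assume j: "j \<in> {-int n..int n}"
    show "fps_cong (Suc N) (fps_const (c j) * (qprod m * ?b j) * fps_X ^ e j)
      (fps_const (c j) * 1 * fps_X ^ e j)"
    proof (cases "nat \<bar>j\<bar> \<le> Suc N")
      case True
      then have "N \<le> nat (int n + j)" "nat (int n + j) + N \<le> 2 * n"
        using assms(3) by linarith+
      then show ?thesis
        using assms(1) by (intro fps_cong_mult fps_cong_refl qprod_mult_qbinomial_cong)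
    next
      case False
      then have "Suc N \<le> e j" using assms(2)[of j] by linarith
      then show ?thesis
        using fps_cong_X_power_mult fps_cong_sym fps_cong_trans by metis
    qed
  qed
  also have "fps_cong (Suc N) \<dots> (theta_series c e)"
    unfolding fps_cong_def
  proof (intro allI impI)
    fix k assume k: "k < Suc N"
    have "(\<Sum>j\<in>{-int n..int n}. fps_const (c j) * 1 * fps_X ^ e j) $ k
        = (\<Sum>j\<in>{-int n..int n}. if e j = k then c j else 0)"
      by (auto simp: fps_sum_nth fps_X_power_nth intro!: sum.cong)
    also have "\<dots> = (\<Sum>j\<in>{j. e j = k}. c j)"
    proof (rule sum.mono_neutral_cong_right)
      show "{j. e j = k} \<subseteq> {-int n..int n}"
      proof
        fix j assume "j \<in> {j. e j = k}"
        then have "nat \<bar>j\<bar> \<le> Suc k" using assms(2)[of j] by simp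
        then show "j \<in> {-int n..int n}" using k assms(3) by simp linarith
      qed
    qed auto
    finally show "(\<Sum>j\<in>{-int n..int n}. fps_const (c j) * 1 * fps_X ^ e j) $ k
        = theta_series c e $ k"
      by simp
  qed
  finally show ?thesis by (simp add: sum_distrib_left mult_ac)
qed

lemma sign_power_cong:
  fixes c :: "'a::comm_ring_1"
  assumes "c * c = 1" "even (a + b)"
  shows "c ^ a = c ^ b"
proof -
  have *: "c ^ a = c ^ (a mod 2)" for a
  proof -
    have "c ^ a = c ^ (2 * (a div 2) + a mod 2)" by simp
    also have "\<dots> = c ^ (a mod 2)"
      using assms(1) by (simp only: power_add power_mult power2_eq_square power_one mult_1)
    finally show ?thesis .
  qed
  have "a mod 2 = b mod 2" using assms(2) by presburger
  then show ?thesis using *[of a] *[of b] by simp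
qed

lemma tri_ge: "j \<le> 0 \<Longrightarrow> nat (- j) \<le> tri j" "nat j \<le> Suc (tri j)"
proof -
  have "- j \<le> int (tri j)" if "j \<le> 0"
  proof -
    have "0 \<le> j * (j + 1)"
      using that by (cases "j = 0") (auto intro: mult_nonpos_nonpos)
    then show ?thesis using tri_times_2[of j] by (simp add: algebra_simps)
  qed
  then show "j \<le> 0 \<Longrightarrow> nat (- j) \<le> tri j" by linarith
  have "j \<le> 1 + int (tri j)"
  proof (cases "j \<ge> 2 \<or> j \<le> 0")
    case True
    then have "0 \<le> (j - 1) * (j - 2)" by (auto intro: mult_nonneg_nonneg mult_nonpos_nonpos)
    then show ?thesis using tri_times_2[of j] by (simp add: algebra_simps)
  next
    case False
    then have "j = 1" by simp
    then show ?thesis by simp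
  qed
  then show "nat j \<le> Suc (tri j)" by linarith
qed

text \<open>Substituting \<open>q = X ^ m\<close> and \<open>z = c X ^ s\<close> with \<open>c = \<plusminus>1\<close>, the factors \<open>z + q ^ Suc i\<close> equal
  \<open>z (1 + c X ^ (m * Suc i - s))\<close>, so that no negative powers are needed.\<close>

theorem jacobi_triple_product:
  fixes c :: "'a::idom"
  assumes c: "c * c = 1" and s: "0 < s" "s < m"
  shows "qprod m * (aprod c m (m - s) * aprod c m s) =
    theta_series (\<lambda>j. c ^ nat \<bar>j\<bar>) (\<lambda>j. nat (int m * int (tri j) + int s * j))"
    (is "_ = theta_series ?c ?e")
  unfolding fps_eq_cong_iff
proof
  fix N :: nat
  \<comment> \<open>Growth of the exponent in both directions, from \<open>s \<ge> 1\<close> for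
    \<open>j \<ge> 0\<close> and from \<open>m - s \<ge> 1\<close> with
    \<open>tri j \<ge> - j\<close> for \<open>j < 0\<close>. In particular \<open>nat\<close> does
    not truncate.\<close>
  have e0: "0 \<le> int m * int (tri j) + int s * j" and e: "nat \<bar>j\<bar> \<le> Suc (?e j)" for j
  proof -
    have "\<bar>j\<bar> \<le> int m * int (tri j) + int s * j"
    proof (cases "j \<ge> 0")
      case True
      then have "1 * j \<le> int s * j" using s by (intro mult_right_mono) auto
      moreover have "0 \<le> int m * int (tri j)" by simp
      ultimately show ?thesis using True by linarith
    next
      case False
      have "int m * (- j) \<le> int m * int (tri j)"
        using tri_ge(1)[of j] False by (intro mult_left_mono) auto
      moreover have "1 * (- j) \<le> (int m - int s) * (- j)"
        using s False by (intro mult_right_mono) auto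
      ultimately show ?thesis using False by (simp add: algebra_simps)
    qed
    then show "0 \<le> int m * int (tri j) + int s * j" "nat \<bar>j\<bar> \<le> Suc (?e j)" by linarith+
  qed
  define n where "n = 2 * N + 2"
  define z where "z = fps_const c * fps_X ^ s"
  let ?q = "fps_X ^ m :: 'a fps"
  have cc: "fps_const c * fps_const c = 1" using c by simp
  have cnz: "c \<noteq> 0" using c by auto
  have ex: "m * i + (m - s) + s = m * Suc i" for i using s by simp
  have "(\<Prod>i<n. z + ?q ^ Suc i) = (\<Prod>i<n. z * (1 + fps_const c * fps_X ^ (m * i + (m - s))))"
  proof (rule prod.cong)
    fix i
    have "?q ^ Suc i = fps_X ^ (m * i + (m - s)) * fps_X ^ s"
      unfolding power_mult[symmetric] power_add[symmetric] ex ..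
    then have "z * (1 + fps_const c * fps_X ^ (m * i + (m - s))) =
      z + (fps_const c * fps_const c) * ?q ^ Suc i"
      unfolding z_def by (simp only: algebra_simps mult_1)
    then show "z + ?q ^ Suc i = z * (1 + fps_const c * fps_X ^ (m * i + (m - s)))"
      using cc by simp
  qed simp
  also have "\<dots> = z ^ n * (\<Prod>i<n. 1 + fps_const c * fps_X ^ (m * i + (m - s)))"
    by (simp add: prod.distrib)
  finally have p1: "(\<Prod>i<n. z + ?q ^ Suc i) = \<dots>" .
  have p2: "(\<Prod>i<n. 1 + z * ?q ^ i) = (\<Prod>i<n. 1 + fps_const c * fps_X ^ (m * i + s))"
    by (simp add: z_def power_mult[symmetric] power_add mult_ac)
  have "z ^ n * ((\<Prod>i<n. 1 + fps_const c * fps_X ^ (m * i + (m - s))) *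
                 (\<Prod>i<n. 1 + fps_const c * fps_X ^ (m * i + s)))
      = (\<Sum>k\<le>2*n. qbinomial ?q (2 * n) k * ?q ^ tri (int k - int n) * z ^ k)"
    using finite_jacobi_triple_product[of ?q z n] unfolding p1 p2 by (simp add: mult_ac)
  \<comment> \<open>Write \<open>k = n + j\<close>. Pulling out \<open>z ^ n\<close> leaves the
    exponent \<open>m * tri j + s * j\<close>, which is nonnegative even where \<open>s * j\<close>
    is not.\<close>
  also have "\<dots> = (\<Sum>k\<le>2*n. z ^ n * (fps_const (?c (int k - int n)) *
      qbinomial ?q (2 * n) (nat (int n + (int k - int n))) * fps_X ^ ?e (int k - int n)))"
  proof (rule sum.cong)
    fix k
    let ?j = "int k - int n"
    have 1: "m * tri ?j + s * k = s * n + ?e ?j"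
    proof -
      have "int (m * tri ?j + s * k) = int (s * n + ?e ?j)"
        using e0[of ?j] by (simp add: algebra_simps)
      then show ?thesis by (simp only: of_nat_eq_iff)
    qed
    have 2: "c ^ k = c ^ (n + nat \<bar>?j\<bar>)"
    proof (rule sign_power_cong[OF c])
      have "even (int (k + (n + nat \<bar>?j\<bar>)))" by auto
      then show "even (k + (n + nat \<bar>?j\<bar>))" by (simp only: even_of_nat_iff)
    qed
    have "?q ^ tri ?j * z ^ k = fps_const (c ^ k) * fps_X ^ (m * tri ?j + s * k)"
      by (simp add: z_def power_mult_distrib power_add mult_ac flip: power_mult)
    also have "\<dots> = z ^ n * (fps_const (?c ?j) * fps_X ^ ?e ?j)"
      unfolding 1 2 by (simp add: z_def power_mult_distrib power_add mult_ac flip: fps_const_mult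
          power_mult)
    finally show "qbinomial ?q (2 * n) k * ?q ^ tri ?j * z ^ k = z ^ n * (fps_const (?c ?j) *
      qbinomial ?q (2 * n) (nat (int n + ?j)) * fps_X ^ ?e ?j)"
      by (simp add: mult_ac)
  qed simp
  also have "\<dots> = z ^ n * (\<Sum>j\<in>{-int n..int n}. fps_const (?c j) *
      qbinomial ?q (2 * n) (nat (int n + j)) * fps_X ^ ?e j)"
    unfolding sum_distrib_left[symmetric]
    by (subst sum_atMost_shift_int[symmetric]) simp
  finally have fin: "(\<Prod>i<n. 1 + fps_const c * fps_X ^ (m * i + (m - s))) *
      (\<Prod>i<n. 1 + fps_const c * fps_X ^ (m * i + s)) =
      (\<Sum>j\<in>{-int n..int n}. fps_const (?c j) *
        qbinomial ?q (2 * n) (nat (int n + j)) * fps_X ^ ?e j)"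
    using cnz by (simp add: z_def)
  have "fps_cong (Suc N) (qprod m * (aprod c m (m - s) * aprod c m s))
    (qprod m * ((\<Prod>i<n. 1 + fps_const c * fps_X ^ (m * i + (m - s))) *
      (\<Prod>i<n. 1 + fps_const c * fps_X ^ (m * i + s))))"
    unfolding aprod_def
    by (intro fps_cong_mult fps_cong_refl fps_infprod_cong infprod_ok_arith)
       (use s in \<open>auto simp: n_def\<close>)
  also have "fps_cong (Suc N) \<dots> (theta_series ?c ?e)"
    unfolding fin by (rule theta_series_cong_qbinomial_sum) (use s e in \<open>auto simp: n_def\<close>)
  finally show "fps_cong N (qprod m * (aprod c m (m - s) * aprod c m s)) (theta_series ?c ?e)"
    by (rule fps_cong_mono) simp
qed

lemma pderiv_sum: "pderiv (\<Sum>i\<in>A. f i) = (\<Sum>i\<in>A. pderiv (f i))"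
  by (induction A rule: infinite_finite_induct) (simp_all add: pderiv_add)

text \<open>Both sides of the finite triple product, as polynomials in \<open>z\<close>, are differentiated at the
  simple root \<open>z = -1\<close>.\<close>

lemma finite_jacobi_cube:
  fixes q :: "'a::{idom,ring_char_0}"
  assumes "q \<noteq> 0"
  shows "- (qfact q (Suc n) * qfact q n) =
    (\<Sum>k\<le>2 * Suc n. of_int (int k) * (-1) ^ (k + Suc n) * qbinomial q (2 * Suc n) k * q ^ tri
        (int k - int (Suc n)))"
proof -
  let ?n = "Suc n"
  \<comment> \<open>The product without the factor \<open>1 + z\<close>, which comes from
    \<open>i = 0\<close> in the second product. At \<open>z = -1\<close> the derivative of
    \<open>(1 + z) * Q\<close> is therefore the value of \<open>Q\<close>.\<close>
  define Q where "Q = (\<Prod>i<?n. [:q ^ Suc i, 1:]) * (\<Prod>i<n. [:1, q ^ Suc i:])"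
  define b where "b k = qbinomial q (2 * ?n) k * q ^ tri (int k - int ?n)" for k
  have p: "[:1, 1:] * Q = (\<Prod>i<?n. [:q ^ Suc i, 1:]) * (\<Prod>i<?n. [:1, q ^ i:])"
    unfolding Q_def prod.lessThan_Suc_shift[of "\<lambda>i. [:1, q ^ i:]"] power_0 by (simp only: mult_ac)
  have "poly ([:1, 1:] * Q) z = poly (\<Sum>k\<le>2*?n. monom (b k) k) z" for z
    using finite_jacobi_triple_product[OF assms, of z ?n] unfolding p
    by (simp add: poly_prod poly_sum poly_monom b_def add.commute mult.commute
        del: prod.lessThan_Suc sum.atMost_Suc)
  then have "[:1, 1:] * Q = (\<Sum>k\<le>2*?n. monom (b k) k)"
    by (simp add: poly_eq_poly_eq_iff[symmetric] fun_eq_iff)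
  then have "poly (pderiv ([:1, 1:] * Q)) (-1) = poly (pderiv (\<Sum>k\<le>2*?n. monom (b k) k)) (-1)"
    by simp
  moreover have "poly (pderiv ([:1, 1:] * Q)) (-1) = poly Q (-1)"
    by (simp only: pderiv_mult poly_add poly_mult) (simp add: pderiv_pCons)
  moreover have "poly Q (-1) = (-1) ^ ?n * (qfact q ?n * qfact q n)"
  proof -
    have "(\<Prod>i<?n. q ^ Suc i - 1) = (\<Prod>i<?n. (-1) * (1 - q ^ Suc i))"
      by (rule prod.cong) auto
    also have "\<dots> = (-1) ^ ?n * qfact q ?n"
      unfolding qfact_def prod.distrib by (simp only: prod_constant card_lessThan)
    finally show ?thesis
      unfolding Q_def by (simp add: poly_prod qfact_def del: prod.lessThan_Suc)
  qed
  \<comment> \<open>The truncated exponent \<open>k - 1\<close> is harmless at \<open>k = 0\<close>,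
    where the coefficient is 0.\<close>
  moreover have "poly (pderiv (\<Sum>k\<le>2*?n. monom (b k) k)) (-1) = (\<Sum>k\<le>2*?n. of_nat k * b k * (-1) ^
      (k - 1))"
    by (simp add: pderiv_sum pderiv_monom poly_sum poly_monom del: sum.atMost_Suc)
  ultimately have "(-1) ^ ?n * (qfact q ?n * qfact q n) = (\<Sum>k\<le>2*?n. of_nat k * b k * (-1) ^
      (k - 1))"
    by simp
  then have "(-1) ^ Suc ?n * ((-1) ^ ?n * (qfact q ?n * qfact q n)) =
      (\<Sum>k\<le>2*?n. (-1) ^ Suc ?n * (of_nat k * b k * (-1) ^ (k - 1)))"
    by (simp only: sum_distrib_left)
  also have "\<dots> = (\<Sum>k\<le>2*?n. of_int (int k) * (-1) ^ (k + ?n) * qbinomial q (2 * ?n) k * q ^ tri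
      (int k - int ?n))"
  proof (rule sum.cong)
    fix k
    show "(-1) ^ Suc ?n * (of_nat k * b k * (-1) ^ (k - 1)) =
      of_int (int k) * (-1) ^ (k + ?n) * qbinomial q (2 * ?n) k * q ^ tri (int k - int ?n)"
      by (cases k) (simp_all add: b_def power_add)
  qed simp
  also have "(-1) ^ Suc ?n * ((-1) ^ ?n * (qfact q ?n * qfact q n)) = - (qfact q ?n * qfact q n)"
  proof -
    have "(-1::'a) ^ Suc ?n * (-1) ^ ?n = -1"
      by (simp flip: power_mult_distrib)
    then show ?thesis by (simp only: mult.assoc[symmetric]) simp
  qed
  finally show ?thesis .
qed

text \<open>The finite cube formula times a third copy of \<open>qprod 1\<close>, in the limit. The
  indices \<open>j = k + 1\<close> and \<open>j = -k\<close> have the same exponent; adding their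
  coefficients cancels the truncation parameter \<open>n\<close> and leaves
  \<open>(-1) ^ k * (2 * k + 1)\<close>.\<close>

theorem jacobi_cube:
  "qprod 1 ^ 3 = (theta_series (\<lambda>k. (-1) ^ k * of_nat (2 * k + 1)) (\<lambda>k. Suc k choose 2)
     :: 'a::{idom,ring_char_0} fps)"
  unfolding fps_eq_cong_iff
proof
  fix N :: nat
  define n where "n = Suc (2 * N + 1)"
  define c :: "int \<Rightarrow> 'a" where "c j = - ((-1) ^ nat \<bar>j\<bar> * of_int (int n + j))" for j
  have "fps_cong (Suc N) (qprod 1 ^ 3) (qprod 1 * (qfact (fps_X ^ 1 :: 'a fps) n * qfact (fps_X ^ 1)
      (2 * N + 1)))"
    unfolding power3_eq_cube mult.assoc
    by (intro fps_cong_mult fps_cong_refl qprod_cong_qfact) (auto simp: n_def)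
  also have "qfact (fps_X ^ 1 :: 'a fps) n * qfact (fps_X ^ 1) (2 * N + 1) =
    - (\<Sum>k\<le>2 * n. of_int (int k) * (-1) ^ (k + n) * qbinomial (fps_X ^ 1) (2 * n) k *
        (fps_X ^ 1) ^ tri (int k - int n))"
    using arg_cong[OF finite_jacobi_cube[of "fps_X ^ 1 :: 'a fps" "2 * N + 1"], of uminus]
    by (simp only: minus_minus n_def) simp
  also have "\<dots> = (\<Sum>k\<le>2 * n. fps_const (c (int k - int n)) *
      qbinomial (fps_X ^ 1) (2 * n) (nat (int n + (int k - int n))) * fps_X ^ tri (int k - int n))"
    unfolding sum_negf[symmetric]
  proof (rule sum.cong)
    fix k
    let ?j = "int k - int n"
    have "(-1) ^ (k + n) = (-1 :: 'a) ^ nat \<bar>?j\<bar>"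
    proof (rule sign_power_cong)
      have "even (int ((k + n) + nat \<bar>?j\<bar>))" by auto
      then show "even ((k + n) + nat \<bar>?j\<bar>)" by (simp only: even_of_nat_iff)
    qed simp
    then have "c ?j = - (of_int (int k) * (-1) ^ (k + n))"
      by (simp add: c_def mult.commute)
    then have "fps_const (c ?j) = - (of_int (int k) * (-1) ^ (k + n))"
      by (simp add: fps_of_int[symmetric] fps_const_neg[symmetric] fps_const_mult[symmetric]
          fps_const_power[symmetric]
         del: fps_const_neg fps_const_mult fps_const_power)
    then show "- (of_int (int k) * (-1) ^ (k + n) * qbinomial (fps_X ^ 1) (2 * n) k *
        (fps_X ^ 1) ^ tri ?j) =
       fps_const (c ?j) * qbinomial (fps_X ^ 1) (2 * n) (nat (int n + ?j)) * fps_X ^ tri ?j"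
      by simp
  qed simp
  also have "\<dots> = (\<Sum>j\<in>{-int n..int n}. fps_const (c j) *
      qbinomial (fps_X ^ 1) (2 * n) (nat (int n + j)) * fps_X ^ tri j)"
    by (rule sum_atMost_shift_int)
  also have "fps_cong (Suc N) (qprod 1 * \<dots>) (theta_series c tri)"
  proof (rule theta_series_cong_qbinomial_sum)
    show "nat \<bar>j\<bar> \<le> Suc (tri j)" for j
      using tri_ge[of j] by (cases "j \<le> 0") auto
  qed (auto simp: n_def)
  also have "theta_series c tri = theta_series (\<lambda>k. (-1) ^ k * of_nat (2 * k + 1))
      (\<lambda>k. Suc k choose 2)"
  proof (rule fps_ext)
    fix t
    have t1: "tri (int k + 1) = Suc k choose 2" and t2: "tri (- int k) = Suc k choose 2" for k
      using choose_2_times_2[of "Suc k"] tri_times_2[of "int k + 1"] tri_times_2[of "- int k"]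
      by (simp_all add: algebra_simps)
    define A where "A = {k. Suc k choose 2 = t}"
    have fin: "finite A"
    proof (rule finite_subset)
      show "A \<subseteq> {..t}"
      proof
        fix k assume "k \<in> A"
        then have "tri (- int k) = t" using t2 by (simp add: A_def)
        then show "k \<in> {..t}" using tri_ge(1)[of "- int k"] by simp
      qed
    qed simp
    have "{j. tri j = t} = (\<lambda>k. int k + 1) ` A \<union> (\<lambda>k. - int k) ` A"
    proof safe
      fix j assume j: "t = tri j" "j \<notin> (\<lambda>k. - int k) ` A"
      have "\<not> j \<le> 0"
      proof
        assume "j \<le> 0"
        then have "- int (nat (- j)) = j" by simp
        then have "nat (- j) \<in> A" "j = - int (nat (- j))"
          using j(1) t2[of "nat (- j)"] by (simp_all add: A_def)
        with j(2) show False by blast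
      qed
      then have "int (nat (j - 1)) + 1 = j" by simp
      then have "nat (j - 1) \<in> A" "j = int (nat (j - 1)) + 1"
        using j(1) t1[of "nat (j - 1)"] by (simp_all add: A_def)
      then show "j \<in> (\<lambda>k. int k + 1) ` A" by blast
    qed (auto simp: A_def t1 t2)
    then have "theta_series c tri $ t = sum c ((\<lambda>k. int k + 1) ` A) + sum c ((\<lambda>k. - int k) ` A)"
      using fin by (simp, subst sum.union_disjoint) auto
    also have "\<dots> = (\<Sum>k\<in>A. c (int k + 1) + c (- int k))"
      by (simp add: sum.reindex inj_on_def sum.distrib)
    also have "\<dots> = (\<Sum>k\<in>A. (-1) ^ k * of_nat (2 * k + 1))"
    proof (rule sum.cong)
      fix k
      have "nat (int k + 1) = Suc k" by simp
      then show "c (int k + 1) + c (- int k) = (-1) ^ k * of_nat (2 * k + 1)"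
        by (simp add: c_def algebra_simps abs_if)
    qed simp
    finally show "theta_series c tri $ t =
        theta_series (\<lambda>k. (-1) ^ k * of_nat (2 * k + 1)) (\<lambda>k. Suc k choose 2) $ t"
      by (simp add: A_def)
  qed
  finally show "fps_cong N (qprod 1 ^ 3)
      (theta_series (\<lambda>k. (-1) ^ k * of_nat (2 * k + 1)) (\<lambda>k. Suc k choose 2) :: 'a fps)"
    by (rule fps_cong_mono) simp
qed

section \<open>Theta functions and their 3-dissections\<close>

lemma fps_infprod_prod:
  fixes d :: nat
  assumes "\<And>r. r < d \<Longrightarrow> infprod_ok (h r)"
  shows "infprod_ok (\<lambda>i. \<Prod>r<d. h r i) \<and>
    fps_infprod (\<lambda>i. \<Prod>r<d. h r i) = (\<Prod>r<d. fps_infprod (h r))"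
  using assms by (induction d) (auto simp: fps_infprod_mult)

text \<open>Sorts the factors by the residue of their index modulo \<open>d\<close>.\<close>

lemma aprod_split:
  assumes "m > 0" "s > 0" "d > 0"
  shows "aprod c m s = (\<Prod>r<d. aprod c (m * d) (m * r + s))"
proof -
  have "aprod c m s = fps_infprod (\<lambda>i. \<Prod>r<d. 1 + fps_const c * fps_X ^ (m * (i * d + r) + s))"
    unfolding aprod_def using assms by (intro fps_infprod_group infprod_ok_arith)
  moreover have "m * (i * d + r) + s = m * d * i + (m * r + s)" for i r
    by (simp add: algebra_simps)
  ultimately have "aprod c m s =
     fps_infprod (\<lambda>i. \<Prod>r<d. 1 + fps_const c * fps_X ^ (m * d * i + (m * r + s)))"
    by (simp only:)
  also have "\<dots> = (\<Prod>r<d. aprod c (m * d) (m * r + s))"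
    unfolding aprod_def
    by (rule fps_infprod_prod[THEN conjunct2], rule infprod_ok_arith) (use assms in auto)
  finally show ?thesis .
qed

text \<open>Factor by factor, \<open>(1 + x) * (1 - x) = 1 - x ^ 2\<close>.\<close>

lemma aprod_one_mult_qprod:
  assumes "m > 0"
  shows "aprod 1 m m * qprod m = (qprod (2 * m) :: 'a::comm_ring_1 fps)"
proof -
  have "aprod 1 m m * qprod m = fps_infprod (\<lambda>i. (1 + fps_const 1 * fps_X ^ (m * i + m)) *
      (1 - fps_X ^ (m * Suc i) :: 'a fps))"
    unfolding aprod_def qprod_def
    by (rule fps_infprod_mult[OF infprod_ok_arith[OF assms assms] infprod_ok_qprod[OF assms],
        symmetric])
  also have "(\<lambda>i. (1 + fps_const 1 * fps_X ^ (m * i + m)) * (1 - fps_X ^ (m * Suc i) :: 'a fps)) =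
    (\<lambda>i. 1 - fps_X ^ (2 * m * Suc i))"
  proof
    fix i
    have "(fps_X :: 'a fps) ^ (2 * m * Suc i) = fps_X ^ (m * Suc i) * fps_X ^ (m * Suc i)"
      by (simp flip: power_add add: algebra_simps)
    then show "(1 + fps_const 1 * fps_X ^ (m * i + m)) * (1 - fps_X ^ (m * Suc i) :: 'a fps) =
      1 - fps_X ^ (2 * m * Suc i)"
      by (simp add: algebra_simps)
  qed
  finally show ?thesis by (simp add: qprod_def)
qed

text \<open>Ramanujan's \<open>\<phi>(-q)\<close> and \<open>\<psi>(q)\<close>, and the auxiliary \<open>\<Omega>(-q)\<close> of the 3-dissection of
  \<open>\<phi>(-q)\<close>. The exponents \<open>2 j\<^sup>2 - j\<close> with \<open>j\<close> running over all integers are the triangular numbers,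
  each hit once.\<close>

definition phi :: "'a::comm_ring_1 fps" where
  "phi = theta_series (\<lambda>j::int. (-1) ^ nat \<bar>j\<bar>) (\<lambda>j. nat (j * j))"

definition psi :: "'a::comm_ring_1 fps" where
  "psi = theta_series (\<lambda>j::int. 1) (\<lambda>j. nat (2 * j * j - j))"

definition omega :: "'a::comm_ring_1 fps" where
  "omega = theta_series (\<lambda>j::int. (-1) ^ nat \<bar>j\<bar>) (\<lambda>j. nat (3 * j * j - 2 * j))"

text \<open>The triple product with \<open>c = -1\<close>, \<open>m = 2\<close>,
  \<open>s = 1\<close>. Splitting \<open>qprod 1\<close> into odd and even exponents identifies the
  square of \<open>aprod (-1) 2 1\<close>.\<close>

lemma phi_qprod: "phi * qprod 2 = (qprod 1 ^ 2 :: 'a::idom fps)"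
proof -
  have e: "(\<lambda>j. nat (int 2 * int (tri j) + int 1 * j)) = (\<lambda>j. nat (j * j))"
    using tri_times_2 by (simp add: fun_eq_iff algebra_simps)
  have "phi = qprod 2 * (aprod (-1) 2 1 * aprod (-1) 2 1 :: 'a fps)"
    using jacobi_triple_product[of "-1 :: 'a" 1 2] unfolding e by (simp add: phi_def)
  moreover have "qprod 1 = (aprod (-1) 2 1 * qprod 2 :: 'a fps)"
    using aprod_split[of 1 1 2 "-1 :: 'a"] by (simp add: qprod_eq_aprod numeral_2_eq_2)
  ultimately show ?thesis by (simp add: power2_eq_square mult_ac)
qed

text \<open>The triple product with \<open>c = 1\<close>, \<open>m = 4\<close>,
  \<open>s = 1\<close>; the factors \<open>1 + fps_X ^ k\<close> then assemble to
  \<open>aprod 1 1 1\<close>, which turns \<open>qprod 1\<close> into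
  \<open>qprod 2\<close>.\<close>

lemma psi_qprod: "psi * qprod 1 = (qprod 2 ^ 2 :: 'a::idom fps)"
proof -
  have e: "(\<lambda>j. nat (int 4 * int (tri j) + int 1 * j)) = (\<lambda>j. nat (2 * j * j - j))"
  proof
    fix j
    have "int 4 * int (tri j) + int 1 * j = 2 * (2 * int (tri j)) + j" by simp
    then show "nat (int 4 * int (tri j) + int 1 * j) = nat (2 * j * j - j)"
      unfolding tri_times_2 by (simp add: algebra_simps)
  qed
  have psi: "psi = qprod 4 * (aprod 1 4 3 * aprod 1 4 1 :: 'a fps)"
    using jacobi_triple_product[of "1 :: 'a" 1 4] unfolding e by (simp add: psi_def)
  have a4: "aprod 1 2 1 = (aprod 1 4 1 * aprod 1 4 3 :: 'a fps)"
    using aprod_split[of 2 1 2 "1 :: 'a"] by (simp add: eval_nat_numeral)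
  have a2: "aprod 1 1 1 = (aprod 1 2 1 * aprod 1 2 2 :: 'a fps)"
    using aprod_split[of 1 1 2 "1 :: 'a"] by (simp add: eval_nat_numeral)
  have q4: "qprod 4 = (aprod 1 2 2 * qprod 2 :: 'a fps)" and q2: "aprod 1 1 1 * qprod 1 =
      (qprod 2 :: 'a fps)"
    using aprod_one_mult_qprod[of 1, where 'a = 'a] aprod_one_mult_qprod[of 2, where 'a = 'a]
        by simp_all
  have "psi * qprod 1 = (aprod 1 1 1 * qprod 1) * (qprod 2 :: 'a fps)"
    unfolding psi a2 a4 q4 by (simp only: mult_ac)
  then show ?thesis unfolding q2 by (simp only: power2_eq_square)
qed

text \<open>The triple product with \<open>c = -1\<close>, \<open>m = 6\<close>,
  \<open>s = 1\<close>. Written in residue classes modulo 6, both sides are the same product of the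
  \<open>aprod (-1) 6 r\<close>.\<close>

lemma omega_qprod: "omega * qprod 2 * qprod 3 = (qprod 1 * qprod 6 ^ 2 :: 'a::idom fps)"
proof -
  have e: "(\<lambda>j. nat (int 6 * int (tri j) + int 1 * j)) = (\<lambda>j. nat (3 * j * j - 2 * j))"
  proof
    fix j
    have "int 6 * int (tri j) + int 1 * j = 3 * (2 * int (tri j)) + j" by simp
    then show "nat (int 6 * int (tri j) + int 1 * j) = nat (3 * j * j - 2 * j)"
      unfolding tri_times_2 by (simp add: algebra_simps)
  qed
  let ?a = "aprod (-1) 6 :: nat \<Rightarrow> 'a fps"
  have o: "omega = qprod 6 * (?a 5 * ?a 1 :: 'a fps)"
    using jacobi_triple_product[of "-1 :: 'a" 1 6] unfolding e by (simp add: omega_def)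
  have q1: "qprod 1 = ?a 1 * ?a 2 * ?a 3 * ?a 4 * ?a 5 * ?a 6"
    using aprod_split[of 1 1 6 "-1 :: 'a"] by (simp add: qprod_eq_aprod eval_nat_numeral)
  have q2: "qprod 2 = ?a 2 * ?a 4 * ?a 6"
    using aprod_split[of 2 2 3 "-1 :: 'a"] by (simp add: qprod_eq_aprod eval_nat_numeral)
  have q3: "qprod 3 = ?a 3 * ?a 6"
    using aprod_split[of 3 3 2 "-1 :: 'a"] by (simp add: qprod_eq_aprod eval_nat_numeral)
  have q6: "qprod 6 = ?a 6" by (simp add: qprod_eq_aprod)
  show ?thesis unfolding o q1 q2 q3 q6 by (simp only: power2_eq_square mult_ac)
qed

section \<open>Substitution of powers of the variable\<close>

lemma fps_compose_X_power_nth: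
  assumes "d > 0"
  shows "(f oo fps_X ^ d) $ n = (if d dvd n then f $ (n div d) else (0 :: 'a::comm_ring_1))"
proof -
  have "(f oo fps_X ^ d) $ n = (\<Sum>i=0..n. if n = d * i then f $ i else 0)"
    by (auto simp: fps_compose_nth power_mult[symmetric] fps_X_power_nth intro!: sum.cong)
  also have "\<dots> = (if d dvd n then f $ (n div d) else 0)"
  proof (cases "d dvd n")
    case True
    then obtain k where k: "n = d * k" by blast
    have "(\<Sum>i=0..n. if n = d * i then f $ i else 0) = (\<Sum>i=0..n. if i = k then f $ i else 0)"
      using assms k by (intro sum.cong) auto
    also have "\<dots> = f $ k" using assms k by (simp add: sum.delta)
    finally show ?thesis using k assms by simp
  next
    case False
    then show ?thesis by (auto intro!: sum.neutral)
  qed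
  finally show ?thesis .
qed

lemma theta_series_compose:
  assumes "d > 0"
  shows "theta_series c e oo fps_X ^ d = theta_series c (\<lambda>j. d * e j)"
proof (rule fps_ext)
  fix n
  have "{j. d * e j = n} = (if d dvd n then {j. e j = n div d} else {})"
    using assms by auto
  then show "(theta_series c e oo fps_X ^ d) $ n = theta_series c (\<lambda>j. d * e j) $ n"
    using assms by (simp add: fps_compose_X_power_nth)
qed

lemma qprod_compose:
  assumes "d > 0" "m > 0"
  shows "qprod m oo fps_X ^ d = (qprod (d * m) :: 'a::idom fps)"
  unfolding qprod_def[of "d * m"]
proof (rule fps_infprod_eqI)
  show "infprod_ok (\<lambda>i. 1 - fps_X ^ (d * m * Suc i) :: 'a fps)"
    using assms by (intro infprod_ok_qprod) simp
  fix N
  have X0: "(fps_X ^ d :: 'a fps) $ 0 = 0" using assms by simp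
  have "fps_cong (Suc N) (qprod m) (\<Prod>i<N. 1 - fps_X ^ (m * Suc i) :: 'a fps)"
    unfolding qprod_def using assms by (intro fps_infprod_cong infprod_ok_qprod) auto
  then have "fps_cong (Suc N) (qprod m oo fps_X ^ d) ((\<Prod>i<N. 1 - fps_X ^
      (m * Suc i) :: 'a fps) oo fps_X ^ d)"
    using assms unfolding fps_cong_def fps_compose_X_power_nth[OF assms(1)]
    by (meson div_le_dividend le_less_trans)
  also have "(\<Prod>i<N. 1 - fps_X ^ (m * Suc i) :: 'a fps) oo fps_X ^ d = (\<Prod>i<N. 1 - fps_X ^
      (d * m * Suc i))"
  proof -
    have "(fps_X :: 'a fps) ^ (m * Suc i) oo fps_X ^ d = fps_X ^ (d * m * Suc i)" for i
      using assms(1) unfolding fps_compose_power[OF X0, symmetric]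
      by (simp only: fps_X_fps_compose_startby0[OF X0] power_mult[symmetric] mult.assoc)
    then show ?thesis
      by (simp only: fps_compose_prod_distrib[OF X0] fps_compose_sub_distrib fps_compose_1)
  qed
  finally have F: "fps_cong (Suc N) (qprod m oo fps_X ^ d) (\<Prod>i<N. 1 - fps_X ^
      (d * m * Suc i) :: 'a fps)" .
  show "\<exists>M\<ge>N. fps_cong (Suc N) (qprod m oo fps_X ^ d) (\<Prod>i<M. 1 - fps_X ^ (d * m * Suc i) :: 'a fps)"
    by (rule exI[of _ N]) (rule conjI[OF order_refl F])
qed

section \<open>Extraction of coefficients in a residue class modulo 3\<close>

definition section3 :: "nat \<Rightarrow> 'a::comm_ring_1 fps \<Rightarrow> 'a fps" where
  "section3 r f = Abs_fps (\<lambda>n. f $ (3 * n + r))"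

lemma section3_nth [simp]: "section3 r f $ n = f $ (3 * n + r)"
  by (simp add: section3_def)

text \<open>A series in \<open>fps_X ^ 3\<close> acts as a scalar: multiplying by it does not mix
  residue classes.\<close>

lemma section3_mult_compose:
  assumes "r < 3"
  shows "section3 r (f * (g oo fps_X ^ 3)) = section3 r f * g"
proof (rule fps_ext)
  fix n
  have "(f * (g oo fps_X ^ 3)) $ (3 * n + r) = ((g oo fps_X ^ 3) * f) $ (3 * n + r)"
    by (simp add: mult.commute)
  also have "\<dots> = (\<Sum>i=0..3*n+r. (if 3 dvd i then g $ (i div 3) else 0) * f $ (3 * n + r - i))"
    by (simp add: fps_mult_nth fps_compose_X_power_nth)
  also have "\<dots> = (\<Sum>i\<in>(\<lambda>i. 3 * i) ` {0..n}. g $ (i div 3) * f $ (3 * n + r - i))"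
    by (rule sum.mono_neutral_cong_right) (use assms in \<open>auto elim!: dvdE simp: image_iff\<close>)
  also have "\<dots> = (\<Sum>i=0..n. g $ i * f $ (3 * n + r - 3 * i))"
    by (simp add: sum.reindex inj_on_def)
  also have "\<dots> = (\<Sum>i=0..n. g $ i * section3 r f $ (n - i))"
    by (rule sum.cong) (auto simp: algebra_simps)
  finally show "section3 r (f * (g oo fps_X ^ 3)) $ n = (section3 r f * g) $ n"
    by (simp add: fps_mult_nth[of g] mult.commute[of _ g] del: section3_nth, simp)
qed

lemma section3_decompose:
  "f = (section3 0 f oo fps_X ^ 3) + fps_X * (section3 1 f oo fps_X ^ 3)
     + fps_X ^ 2 * (section3 2 f oo fps_X ^ 3)"
proof (rule fps_ext)
  fix n
  have *: "(fps_X ^ r * (section3 r f oo fps_X ^ 3)) $ n = (if n mod 3 = r then f $ n else 0)"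
    if "r < 3" for r
  proof (cases "n mod 3 = r")
    case True
    define k where "k = n div 3"
    have "n = 3 * k + r" using True by (auto simp: k_def)
    then show ?thesis using that by (simp add: fps_X_power_mult_nth fps_compose_X_power_nth)
  next
    case False
    have "n < r \<or> \<not> 3 dvd n - r"
    proof (rule ccontr)
      assume *: "\<not> (n < r \<or> \<not> 3 dvd n - r)"
      then obtain k where "n - r = 3 * k" by (auto elim: dvdE)
      then have "n = 3 * k + r" using * by linarith
      then show False using False that by simp
    qed
    then show ?thesis using False by (auto simp: fps_X_power_mult_nth fps_compose_X_power_nth)
  qed
  have "n mod 3 = 0 \<or> n mod 3 = 1 \<or> n mod 3 = 2" by linarith
  then show "f $ n = ((section3 0 f oo fps_X ^ 3) + fps_X * (section3 1 f oo fps_X ^ 3)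
     + fps_X ^ 2 * (section3 2 f oo fps_X ^ 3)) $ n"
    using *[of 0] *[of 1] *[of 2] by (elim disjE) (simp_all del: section3_nth)
qed

text \<open>Here \<open>h\<close> parametrizes the indices whose exponent lies in the residue class,
  and \<open>e'\<close> is the exponent after extraction.\<close>

lemma section3_theta_series:
  assumes "inj h" "\<And>i. e (h i) = 3 * e' i + r" "\<And>j. e j mod 3 = r \<Longrightarrow> j \<in> range h" "r < 3"
  shows "section3 r (theta_series c e) = theta_series (\<lambda>i. c (h i)) e'"
proof (rule fps_ext)
  fix n
  have "{j. e j = 3 * n + r} = h ` {i. e' i = n}"
  proof safe
    fix j assume j: "e j = 3 * n + r"
    then have "e j mod 3 = r" using assms(4) by simp
    then obtain i where "j = h i" using assms(3) by blast
    then show "j \<in> h ` {i. e' i = n}" using j assms(2)[of i] by auto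
  qed (use assms(2) in auto)
  then show "section3 r (theta_series c e) $ n = theta_series (\<lambda>i. c (h i)) e' $ n"
    using assms(1) by (simp add: sum.reindex inj_on_subset)
qed

lemma section3_theta_series_zero:
  assumes "\<And>j. e j mod 3 \<noteq> r" "r < 3"
  shows "section3 r (theta_series c e) = 0"
proof (rule fps_ext)
  fix n
  have "e j \<noteq> 3 * n + r" for j
  proof
    assume "e j = 3 * n + r"
    then have "e j mod 3 = r" using assms(2) by simp
    then show False using assms(1) by blast
  qed
  then have "{j. e j = 3 * n + r} = {}" by blast
  then show "section3 r (theta_series c e) $ n = 0 $ n" by simp
qed

section \<open>Dissections of \<open>phi\<close>, \<open>psi\<close> and the cube of
  \<open>qprod 2\<close>\<close>

lemma minus_one_power_nat_abs:
  fixes i j :: int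
  assumes "even (i + j)"
  shows "(-1 :: 'a::comm_ring_1) ^ nat \<bar>i\<bar> = (-1) ^ nat \<bar>j\<bar>"
  by (rule sign_power_cong) (use assms in \<open>simp_all add: even_nat_iff\<close>)

lemma nat_mod_3_int:
  fixes x :: int
  shows "x \<ge> 0 \<Longrightarrow> nat x mod 3 = r \<Longrightarrow> x mod 3 = int r"
  by (metis int_nat_eq of_nat_mod of_nat_numeral)

lemma int_cases_mod_3:
  obtains i :: int where "j = 3 * i" | i where "j = 3 * i + 1" | i where "j = 3 * i - 1"
proof -
  have "j = 3 * (j div 3) \<or> j = 3 * (j div 3) + 1 \<or> j = 3 * (j div 3 + 1) - 1"
    by presburger
  then show ?thesis using that by blast
qed

lemma mod_3_simps:
  "(3 * i + 1) mod 3 = (1 :: int)" "(3 * k + 2) mod 3 = (2 :: nat)"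
  by presburger+

lemma square_mod_3:
  fixes j :: int
  shows "j * j mod 3 = 0 \<and> 3 dvd j \<or> j * j mod 3 = 1"
proof (cases j rule: int_cases_mod_3)
  case (1 i)
  then show ?thesis by simp
next
  case (2 i)
  have "j * j = 3 * (3 * i * i + 2 * i) + 1" unfolding 2 by (simp add: algebra_simps)
  then show ?thesis by (simp only: mod_3_simps) simp
next
  case (3 i)
  have "j * j = 3 * (3 * i * i - 2 * i) + 1" unfolding 3 by (simp add: algebra_simps)
  then show ?thesis by (simp only: mod_3_simps) simp
qed

lemma section3_phi_0: "section3 0 phi = (phi oo fps_X ^ 3 :: 'a::comm_ring_1 fps)"
proof -
  have "section3 0 (phi :: 'a fps) = theta_series (\<lambda>i::int. (-1) ^ nat \<bar>3 * i\<bar>) (\<lambda>i. 3 * nat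
      (i * i))"
    unfolding phi_def
  proof (rule section3_theta_series)
    fix j :: int assume "nat (j * j) mod 3 = 0"
    then have "j * j mod 3 = 0" using nat_mod_3_int[of "j * j" 0] by simp
    then have "3 dvd j" using square_mod_3[of j] by simp
    then show "j \<in> range (\<lambda>i. 3 * i)" by (auto elim: dvdE)
  next
    show "nat ((3 * i) * (3 * i)) = 3 * (3 * nat (i * i)) + 0" for i :: int
      by (simp add: nat_mult_distrib)
  qed (auto simp: inj_on_def)
  also have "(\<lambda>i::int. (-1 :: 'a) ^ nat \<bar>3 * i\<bar>) = (\<lambda>i. (-1) ^ nat \<bar>i\<bar>)"
    by (rule ext, rule minus_one_power_nat_abs) simp
  finally show ?thesis unfolding phi_def by (simp add: theta_series_compose)
qed

lemma section3_phi_2: "section3 2 phi = (0 :: 'a::comm_ring_1 fps)"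
  unfolding phi_def
proof (rule section3_theta_series_zero)
  fix j :: int
  show "nat (j * j) mod 3 \<noteq> 2"
  proof
    assume "nat (j * j) mod 3 = 2"
    then have "j * j mod 3 = 2" using nat_mod_3_int[of "j * j" 2] by simp
    then show False using square_mod_3[of j] by simp
  qed
qed simp

text \<open>The squares of residue 1 come from \<open>j = 3 * i - 1\<close> and
  \<open>j = 1 - 3 * i\<close>, with common reduced exponent \<open>3 * i * i - 2 * i\<close>. The
  two families give the factor 2, and the parity of \<open>j\<close>, opposite to that of
  \<open>i\<close>, gives the sign.\<close>

lemma section3_phi_1: "section3 1 phi = (- 2 * omega :: 'a::comm_ring_1 fps)"
proof (rule fps_ext)
  fix n
  define A where "A = {i :: int. nat (3 * i * i - 2 * i) = n}"
  have nn: "3 * i * i - 2 * i \<ge> 0" for i :: int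
  proof (cases "i \<ge> 1")
    case True
    then have "0 \<le> i * (3 * i - 2)" by simp
    then show ?thesis by (simp add: algebra_simps)
  next
    case False
    then have "0 \<le> i * (3 * i - 2)" by (simp add: mult_nonpos_nonpos)
    then show ?thesis by (simp add: algebra_simps)
  qed
  have sq: "j * j = 3 * (3 * i * i - 2 * i) + 1" if "j = 3 * i - 1 \<or> j = 1 - 3 * i" for i j :: int
    using that by (elim disjE) (hypsubst, simp add: algebra_simps)+
  have iff: "nat (j * j) = 3 * n + 1 \<longleftrightarrow> i \<in> A" if "j = 3 * i - 1 \<or> j = 1 - 3 * i" for i j :: int
    using nn[of i] unfolding A_def sq[OF that] by auto
  have fin: "finite A"
  proof (rule finite_subset)
    show "A \<subseteq> {- int n..int n}"
    proof
      fix i assume "i \<in> A"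
      then have n: "3 * i * i - 2 * i = int n" using nn[of i] by (auto simp: A_def)
      have "0 \<le> (i - 1) * i" by (cases "i \<ge> 1") (auto simp: mult_nonpos_nonpos)
      then have "i \<le> i * i" by (simp add: algebra_simps)
      moreover have "0 \<le> i * i" by simp
      moreover have "0 \<le> (i + 1) * i" by (cases "i \<ge> 0") (auto simp: mult_nonpos_nonpos)
      then have "- i \<le> i * i" by (simp add: algebra_simps)
      ultimately show "i \<in> {- int n..int n}" using n by simp
    qed
  qed simp
  have "{j::int. nat (j * j) = 3 * n + 1} = (\<lambda>i. 3 * i - 1) ` A \<union> (\<lambda>i. 1 - 3 * i) ` A"
  proof (intro equalityI subsetI)
    fix j :: int assume "j \<in> {j. nat (j * j) = 3 * n + 1}"
    then have j: "nat (j * j) = 3 * n + 1" by simp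
    then have "nat (j * j) mod 3 = 1" by simp
    then have j3: "j * j mod 3 = 1" using nat_mod_3_int[of "j * j" 1] by simp
    show "j \<in> (\<lambda>i. 3 * i - 1) ` A \<union> (\<lambda>i. 1 - 3 * i) ` A"
    proof (cases j rule: int_cases_mod_3)
      case (1 i)
      then show ?thesis using j3 by simp
    next
      case (2 i)
      then have "j = 1 - 3 * (- i)" by simp
      then show ?thesis using j iff by blast
    next
      case (3 i)
      then show ?thesis using j iff by blast
    qed
  next
    fix j assume "j \<in> (\<lambda>i. 3 * i - 1) ` A \<union> (\<lambda>i. 1 - 3 * i) ` A"
    then show "j \<in> {j. nat (j * j) = 3 * n + 1}" using iff by blast
  qed
  moreover have "(\<lambda>i. 3 * i - 1) ` A \<inter> (\<lambda>i. 1 - 3 * i) ` A = {}"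
    by (auto, presburger)
  ultimately have "section3 1 phi $ n =
    (\<Sum>i\<in>A. (-1 :: 'a) ^ nat \<bar>3 * i - 1\<bar>) + (\<Sum>i\<in>A. (-1) ^ nat \<bar>1 - 3 * i\<bar>)"
    using fin by (simp add: phi_def sum.union_disjoint sum.reindex inj_on_def)
  also have "(\<Sum>i\<in>A. (-1 :: 'a) ^ nat \<bar>3 * i - 1\<bar>) = (\<Sum>i\<in>A. (-1) ^ nat \<bar>i + 1\<bar>)"
    by (rule sum.cong, simp, rule minus_one_power_nat_abs) presburger
  also have "(\<Sum>i\<in>A. (-1 :: 'a) ^ nat \<bar>1 - 3 * i\<bar>) = (\<Sum>i\<in>A. (-1) ^ nat \<bar>i + 1\<bar>)"
    by (rule sum.cong, simp, rule minus_one_power_nat_abs) presburger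
  also have "(\<Sum>i\<in>A. (-1 :: 'a) ^ nat \<bar>i + 1\<bar>) = (\<Sum>i\<in>A. - ((-1) ^ nat \<bar>i\<bar>))"
  proof (rule sum.cong)
    fix i :: int
    have "(-1 :: 'a) ^ nat \<bar>i + 1\<bar> = (-1) ^ Suc (nat \<bar>i\<bar>)"
      by (rule sign_power_cong) (simp_all add: even_nat_iff)
    then show "(-1 :: 'a) ^ nat \<bar>i + 1\<bar> = - ((-1) ^ nat \<bar>i\<bar>)" by simp
  qed simp
  finally show "section3 1 phi $ n = (- 2 * omega :: 'a fps) $ n"
    by (simp add: omega_def sum_negf A_def numeral_fps_const)
qed

text \<open>Residue 1 occurs exactly for \<open>j = 1 - 3 * i\<close>, where the exponent is
  \<open>9 * (2 * i * i - i) + 1\<close>: the triangular numbers reappear, scaled by 9.\<close>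

lemma section3_psi_1: "section3 1 psi = (psi oo fps_X ^ 3 :: 'a::comm_ring_1 fps)"
proof -
  have nn: "2 * j * j - j \<ge> 0" for j :: int
  proof (cases "j \<ge> 1")
    case True
    then have "0 \<le> j * (2 * j - 1)" by simp
    then show ?thesis by (simp add: algebra_simps)
  next
    case False
    then have "0 \<le> j * (2 * j - 1)" by (simp add: mult_nonpos_nonpos)
    then show ?thesis by (simp add: algebra_simps)
  qed
  have "section3 1 (psi :: 'a fps) = theta_series (\<lambda>i::int. 1) (\<lambda>i. 3 * nat (2 * i * i - i))"
    unfolding psi_def
  proof (rule section3_theta_series)
    fix j :: int assume "nat (2 * j * j - j) mod 3 = 1"
    then have j: "(2 * j * j - j) mod 3 = 1" using nat_mod_3_int[OF nn, of j 1] by simp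
    show "j \<in> range (\<lambda>i. 1 - 3 * i)"
    proof (cases j rule: int_cases_mod_3)
      case (1 i)
      have "(2 * j * j - j) = 3 * (6 * i * i - i)" unfolding 1 by (simp add: algebra_simps)
      then show ?thesis using j by simp
    next
      case (2 i)
      then have "j = 1 - 3 * (- i)" by simp
      then show ?thesis by blast
    next
      case (3 i)
      have "(2 * j * j - j) = 3 * (6 * i * i - 5 * i + 1)" unfolding 3 by (simp add: algebra_simps)
      then show ?thesis using j by simp
    qed
  next
    fix i :: int
    have E: "2 * (1 - 3 * i) * (1 - 3 * i) - (1 - 3 * i) = 9 * (2 * i * i - i) + 1"
      by (simp add: algebra_simps)
    show "nat (2 * (1 - 3 * i) * (1 - 3 * i) - (1 - 3 * i)) = 3 * (3 * nat (2 * i * i - i)) + 1"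
    proof -
      have "nat (9 * t + 1) = 3 * (3 * nat t) + 1" if "t \<ge> 0" for t :: int
        using that by linarith
      then show ?thesis unfolding E using nn[of i] by blast
    qed
  qed (auto simp: inj_on_def)
  then show ?thesis unfolding psi_def by (simp add: theta_series_compose)
qed

lemma section3_psi_2: "section3 2 psi = (0 :: 'a::comm_ring_1 fps)"
  unfolding psi_def
proof (rule section3_theta_series_zero)
  fix j :: int
  show "nat (2 * j * j - j) mod 3 \<noteq> 2"
  proof
    assume n: "nat (2 * j * j - j) mod 3 = 2"
    then have "2 * j * j - j \<ge> 0" by (cases "2 * j * j - j \<ge> 0") auto
    with n have j: "(2 * j * j - j) mod 3 = 2" using nat_mod_3_int[of "2 * j * j - j" 2] by simp
    show False
    proof (cases j rule: int_cases_mod_3)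
      case (1 i)
      have "(2 * j * j - j) = 3 * (6 * i * i - i)" unfolding 1 by (simp add: algebra_simps)
      then show ?thesis using j by simp
    next
      case (2 i)
      have "(2 * j * j - j) = 3 * (6 * i * i + 3 * i) + 1" unfolding 2 by (simp add: algebra_simps)
      then have "(2 * j * j - j) mod 3 = 1" by (simp only: mod_3_simps)
      then show ?thesis using j by simp
    next
      case (3 i)
      have "(2 * j * j - j) = 3 * (6 * i * i - 5 * i + 1)" unfolding 3 by (simp add: algebra_simps)
      then show ?thesis using j by simp
    qed
  qed
qed simp

lemma qprod_cube:
  assumes "d > 0"
  shows "qprod d ^ 3 = (theta_series (\<lambda>k. (-1) ^ k * of_nat (2 * k + 1)) (\<lambda>k. d * (Suc k choose 2))
     :: 'a::{idom,ring_char_0} fps)"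
proof -
  have "qprod d ^ 3 = ((qprod 1 ^ 3) oo fps_X ^ d :: 'a fps)"
    using assms by (subst fps_compose_power[symmetric])
        (simp_all add: qprod_compose[of d 1, simplified])
  then show ?thesis unfolding jacobi_cube by (simp only: theta_series_compose[OF assms])
qed

lemma Suc_choose_2_double: "2 * (Suc k choose 2) = k * (k + 1)"
  by (induction k) (simp_all add: numeral_2_eq_2)

lemma nat_cases_mod_3:
  obtains i :: nat where "j = 3 * i" | i where "j = 3 * i + 1" | i where "j = 3 * i + 2"
proof -
  have "j = 3 * (j div 3) \<or> j = 3 * (j div 3) + 1 \<or> j = 3 * (j div 3) + 2"
    by presburger
  then show ?thesis using that by blast
qed

lemma section3_qprod_2_cube_1: "section3 1 (qprod 2 ^ 3 :: 'a::{idom,ring_char_0} fps) = 0"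
  unfolding qprod_cube[OF zero_less_numeral] Suc_choose_2_double
proof (rule section3_theta_series_zero)
  fix k :: nat
  show "k * (k + 1) mod 3 \<noteq> 1"
  proof (cases k rule: nat_cases_mod_3)
    case (1 i)
    have "k * (k + 1) = 3 * (i * (3 * i + 1))" unfolding 1 by (simp add: algebra_simps)
    then show ?thesis by simp
  next
    case (2 i)
    have "k * (k + 1) = 3 * (3 * i * i + 3 * i) + 2" unfolding 2 by (simp add: algebra_simps)
    then show ?thesis by (simp only: mod_3_simps)
  next
    case (3 i)
    have "k * (k + 1) = 3 * ((3 * i + 2) * (i + 1))" unfolding 3 by (simp add: algebra_simps)
    then show ?thesis by simp
  qed
qed simp

text \<open>Only \<open>k = 3 * i + 1\<close> contributes. There
  \<open>k * (k + 1) = 9 * i * (i + 1) + 2\<close> and \<open>2 * k + 1 = 3 * (2 * i + 1)\<close>,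
  while the sign changes; hence the factor \<open>- 3\<close>.\<close>

lemma section3_qprod_2_cube_2:
  "section3 2 (qprod 2 ^ 3) = (- 3 * qprod 6 ^ 3 :: 'a::{idom,ring_char_0} fps)"
proof -
  have "section3 2 (qprod 2 ^ 3 :: 'a fps) =
     theta_series (\<lambda>i. (-1) ^ (3 * i + 1) * of_nat (2 * (3 * i + 1) + 1)) (\<lambda>i. 6 *
         (Suc i choose 2))"
    unfolding qprod_cube[OF zero_less_numeral] Suc_choose_2_double
  proof (rule section3_theta_series)
    fix k :: nat assume k: "k * (k + 1) mod 3 = 2"
    show "k \<in> range (\<lambda>i. 3 * i + 1)"
    proof (cases k rule: nat_cases_mod_3)
      case (1 i)
      have "k * (k + 1) = 3 * (i * (3 * i + 1))" unfolding 1 by (simp add: algebra_simps)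
      then show ?thesis using k by simp
    next
      case (2 i)
      then show ?thesis by blast
    next
      case (3 i)
      have "k * (k + 1) = 3 * ((3 * i + 2) * (i + 1))" unfolding 3 by (simp add: algebra_simps)
      then show ?thesis using k by simp
    qed
  next
    fix i
    show "(3 * i + 1) * (3 * i + 1 + 1) = 3 * (6 * (Suc i choose 2)) + 2"
      using Suc_choose_2_double[of i] by (simp add: algebra_simps)
  qed (auto simp: inj_on_def)
  also have "\<dots> = - 3 * qprod 6 ^ 3"
  proof (rule fps_ext)
    fix n
    have c: "(-1) ^ (3 * i + 1) * of_nat (2 * (3 * i + 1) + 1) = - 3 * ((-1) ^ i * of_nat
        (2 * i + 1) :: 'a)" for i
    proof -
      have "(-1 :: 'a) ^ (3 * i + 1) = - ((-1) ^ i)"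
        using sign_power_cong[of "-1 :: 'a" "3 * i + 1" "Suc i"] by simp
      then show ?thesis by (simp add: algebra_simps)
    qed
    show "theta_series (\<lambda>i. (-1) ^ (3 * i + 1) * of_nat (2 * (3 * i + 1) + 1)) (\<lambda>i. 6 *
        (Suc i choose 2)) $ n
       = (- 3 * qprod 6 ^ 3 :: 'a fps) $ n"
      unfolding c qprod_cube[OF zero_less_numeral]
      by (simp add: numeral_fps_const sum_distrib_left sum_negf)
  qed
  finally show ?thesis .
qed

section \<open>The norm of \<open>\<phi>(-q)\<close>\<close>

definition fps_scale :: "'a::comm_ring_1 \<Rightarrow> 'a fps \<Rightarrow> 'a fps" where
  "fps_scale w f = f oo (fps_const w * fps_X)"

lemma fps_scale_nth [simp]: "fps_scale w f $ n = w ^ n * f $ n"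
  by (simp add: fps_scale_def fps_compose_linear)

lemma fps_scale_mult: "fps_scale w (f * g) = fps_scale w f * fps_scale w (g :: 'a::idom fps)"
  by (simp add: fps_scale_def fps_compose_mult_distrib)

lemma fps_scale_prod: "fps_scale w (\<Prod>i\<in>A. f i) = (\<Prod>i\<in>A. fps_scale w (f i) :: 'a::idom fps)"
  by (simp add: fps_scale_def fps_compose_prod_distrib)

lemma fps_scale_cong: "fps_cong N f g \<Longrightarrow> fps_cong N (fps_scale w f) (fps_scale w g)"
  by (simp add: fps_cong_def)

lemma fps_scale_infprod:
  fixes g :: "nat \<Rightarrow> 'a::idom fps"
  assumes "infprod_ok g"
  shows "infprod_ok (\<lambda>i. fps_scale w (g i)) \<and>
    fps_scale w (fps_infprod g) = fps_infprod (\<lambda>i. fps_scale w (g i))"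
proof -
  have ok: "infprod_ok (\<lambda>i. fps_scale w (g i))"
    unfolding infprod_ok_def
  proof
    fix i
    have "fps_cong (Suc i) (fps_scale w (g i)) (fps_scale w 1)"
      using assms by (intro fps_scale_cong) (simp add: infprod_ok_def)
    then show "fps_cong (Suc i) (fps_scale w (g i)) 1"
      by (simp add: fps_scale_def)
  qed
  moreover have "fps_scale w (fps_infprod g) = fps_infprod (\<lambda>i. fps_scale w (g i))"
  proof (rule fps_infprod_eqI[OF ok])
    fix N :: nat
    have "fps_cong (Suc N) (fps_scale w (fps_infprod g)) (fps_scale w (\<Prod>i<N. g i))"
      by (intro fps_scale_cong fps_infprod_cong assms order_refl)
    then have "fps_cong (Suc N) (fps_scale w (fps_infprod g)) (\<Prod>i<N. fps_scale w (g i))"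
      unfolding fps_scale_prod .
    then show "\<exists>M\<ge>N. fps_cong (Suc N) (fps_scale w (fps_infprod g)) (\<Prod>i<M. fps_scale w (g i))"
      by (intro exI[of _ N] conjI order_refl)
  qed
  ultimately show ?thesis ..
qed

text \<open>For \<open>w\<close> a primitive cube root of unity this is the norm from series in \<open>X\<close> to series in
  \<open>X\<^sup>3\<close>.\<close>

definition norm3 :: "'a::comm_ring_1 \<Rightarrow> 'a fps \<Rightarrow> 'a fps" where
  "norm3 w f = f * fps_scale w f * fps_scale (w ^ 2) f"

lemma norm3_mult: "norm3 w (f * g) = norm3 w f * norm3 w (g :: 'a::idom fps)"
  by (simp add: norm3_def fps_scale_mult mult_ac)

lemma norm3_infprod:
  fixes g :: "nat \<Rightarrow> 'a::idom fps"
  assumes "infprod_ok g"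
  shows "norm3 w (fps_infprod g) = fps_infprod (\<lambda>i. norm3 w (g i))"
  unfolding norm3_def using assms fps_scale_infprod[OF assms]
  by (simp add: fps_infprod_mult infprod_ok_mult)

lemma cube_root_power:
  fixes w :: "'a::idom"
  assumes "w ^ 2 + w + 1 = 0"
  shows "w ^ k = (if k mod 3 = 0 then 1 else if k mod 3 = 1 then w else w ^ 2)"
proof -
  have "w ^ 3 - 1 = (w - 1) * (w ^ 2 + w + 1)"
    by (simp add: algebra_simps power2_eq_square power3_eq_cube)
  then have w3: "w ^ 3 = 1" using assms by simp
  have "w ^ k = w ^ (3 * (k div 3) + k mod 3)" by simp
  also have "\<dots> = w ^ (k mod 3)" by (simp only: power_add power_mult w3 power_one mult_1)
  finally have *: "w ^ k = w ^ (k mod 3)" .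
  have "k mod 3 = 0 \<or> k mod 3 = 1 \<or> k mod 3 = 2" by linarith
  then show ?thesis unfolding * by auto
qed

lemma cube_minus_cube_factor:
  fixes w :: "'a::idom"
  assumes "w ^ 2 + w + 1 = 0"
  shows "(a - y) * (a - w * y) * (a - w ^ 2 * y) = a ^ 3 - y ^ 3"
proof -
  have "(a - y) * (a - w * y) * (a - w ^ 2 * y) =
      a ^ 3 - (w ^ 2 + w + 1) * a ^ 2 * y + w * (w ^ 2 + w + 1) * a * y ^ 2 - w ^ 3 * y ^ 3"
    by (simp add: algebra_simps power2_eq_square power3_eq_cube)
  then show ?thesis using assms cube_root_power[OF assms, of 3] by simp
qed

text \<open>If 3 divides \<open>k\<close>, the three conjugates coincide. Otherwise
  \<open>w ^ k\<close> is again a primitive cube root of unity and the conjugates multiply to a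
  difference of cubes.\<close>

lemma norm3_one_minus_X_power:
  fixes w :: "'a::idom"
  assumes w: "w ^ 2 + w + 1 = 0"
  shows "norm3 w (1 - fps_X ^ k) = (if 3 dvd k then (1 - fps_X ^ k) ^ 3 else 1 - fps_X ^ (3 * k))"
proof -
  have sc: "fps_scale v (1 - fps_X ^ k) = 1 - fps_const (v ^ k) * fps_X ^ k" for v :: 'a
    by (rule fps_ext) (auto simp: fps_X_power_nth)
  have w2: "(w ^ 2) ^ k = (w ^ k) ^ 2" by (simp flip: power_mult add: mult.commute)
  have n: "norm3 w (1 - fps_X ^ k) = (1 - fps_X ^ k) * (1 - fps_const (w ^ k) * fps_X ^ k) *
      (1 - fps_const ((w ^ k) ^ 2) * fps_X ^ k)"
    unfolding norm3_def sc w2 ..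
  show ?thesis
  proof (cases "3 dvd k")
    case True
    then have "w ^ k = 1" using cube_root_power[OF w, of k] by (simp add: dvd_eq_mod_eq_0)
    then show ?thesis using True unfolding n by (simp add: power3_eq_cube)
  next
    case False
    define v where "v = fps_const (w ^ k)"
    have "k mod 3 \<noteq> 0" using False by presburger
    then have "w ^ k = w \<or> w ^ k = w ^ 2" using cube_root_power[OF w, of k] by simp
    moreover have "(w ^ 2) ^ 2 = w" using cube_root_power[OF w, of 4] by (simp flip: power_mult)
    ultimately have "(w ^ k) ^ 2 + w ^ k + 1 = 0" using w by (auto simp: algebra_simps)
    moreover have "v ^ 2 + v + 1 = fps_const ((w ^ k) ^ 2 + w ^ k + 1)"
      unfolding v_def fps_const_power fps_const_1_eq_1[symmetric] fps_const_add ..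
    ultimately have v: "v ^ 2 + v + 1 = 0" by (simp only: fps_const_0_eq_0)
    define y where "y = (fps_X :: 'a fps) ^ k"
    have "norm3 w (1 - fps_X ^ k) = (1 - y) * (1 - v * y) * (1 - v ^ 2 * y)"
      unfolding n v_def y_def fps_const_power ..
    also have "\<dots> = 1 - y ^ 3" using cube_minus_cube_factor[OF v, of 1 y] by simp
    finally show ?thesis using False by (simp add: y_def power_mult[symmetric] mult.commute)
  qed
qed

text \<open>Factors with index divisible by 3 are cubed and give \<open>qprod (3 * m) ^ 3\<close>.
  The others give \<open>qprod (3 * m)\<close> without the factors that make up
  \<open>qprod (9 * m)\<close>, which the left side supplies. As 3 does not divide \<open>m\<close>,
  the index alone decides the case.\<close>

lemma norm3_qprod:
  fixes w :: "'a::idom"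
  assumes w: "w ^ 2 + w + 1 = 0" and m: "\<not> 3 dvd m"
  shows "norm3 w (qprod m) * qprod (9 * m) = qprod (3 * m) ^ 4"
proof -
  have m0: "m > 0" using m by (cases "m = 0") auto
  let ?A = "\<lambda>i. if 3 dvd Suc i then 1 - fps_X ^ (m * Suc i) else (1 :: 'a fps)"
  let ?B = "\<lambda>i. if 3 dvd Suc i then 1 - fps_X ^ (3 * m * Suc i) else (1 :: 'a fps)"
  let ?C = "\<lambda>i. 1 - fps_X ^ (3 * m * Suc i) :: 'a fps"
  let ?D = "\<lambda>i. norm3 w (1 - fps_X ^ (m * Suc i))"
  have okC: "infprod_ok ?C" using m0 by (intro infprod_ok_qprod) simp
  have ok: "infprod_ok (\<lambda>i. 1 - fps_X ^ (m * Suc i) :: 'a fps)" using m0 by (rule infprod_ok_qprod)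
  have okA: "infprod_ok ?A" and okB: "infprod_ok ?B"
    using ok okC by (auto simp: infprod_ok_def)
  have okD: "infprod_ok ?D"
    unfolding norm3_def using ok fps_scale_infprod[OF ok] by (intro infprod_ok_mult) blast+
  have "qprod (9 * m) = fps_infprod ?B"
  proof -
    have "(\<lambda>i. 9 * m * Suc i) = (\<lambda>i. 3 * m * (3 * Suc i))" by (simp add: fun_eq_iff algebra_simps)
    then show ?thesis
      unfolding qprod_def using fps_infprod_multiples[of "\<lambda>k. 1 - fps_X ^ (3 * m * k)" 3] okC
      by (simp only: fun_eq_iff) simp
  qed
  moreover have "qprod (3 * m) = fps_infprod ?A"
  proof -
    have "(\<lambda>i. 3 * m * Suc i) = (\<lambda>i. m * (3 * Suc i))" by (simp add: fun_eq_iff algebra_simps)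
    then show ?thesis
      unfolding qprod_def using fps_infprod_multiples[of "\<lambda>k. 1 - fps_X ^ (m * k)" 3] ok
      by (simp only: fun_eq_iff) simp
  qed
  moreover have "norm3 w (qprod m) = fps_infprod ?D"
    unfolding qprod_def by (rule norm3_infprod[OF ok])
  moreover have "fps_infprod ?D * fps_infprod ?B = fps_infprod ?A ^ 3 * fps_infprod ?C"
  proof -
    have "?D i * ?B i = ?A i ^ 3 * ?C i" for i
    proof -
      have "3 dvd m * Suc i \<longleftrightarrow> 3 dvd Suc i"
        using m by (simp add: prime_dvd_mult_iff del: mult_Suc_right)
      then show ?thesis
        unfolding norm3_one_minus_X_power[OF w] by (simp add: mult.assoc del: mult_Suc_right)
    qed
    then have "fps_infprod (\<lambda>i. ?D i * ?B i) = fps_infprod (\<lambda>i. ?A i ^ 3 * ?C i)" by simp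
    then show ?thesis
      by (simp only: fps_infprod_mult[OF okD okB] fps_infprod_mult[OF infprod_ok_power[OF okA] okC]
          fps_infprod_power[OF okA])
  qed
  moreover have "fps_infprod ?C = qprod (3 * m)" unfolding qprod_def ..
  ultimately have "norm3 w (qprod m) * qprod (9 * m) = qprod (3 * m) ^ 3 * qprod (3 * m)"
    by simp
  then show ?thesis by (simp only: power4_eq_xxxx power3_eq_cube)
qed

text \<open>The change of coefficients along \<open>of_int\<close>. The norm needs a complex cube
  root of unity, whereas the divisibility by 5 concerns integer series.\<close>

definition fps_of_ints :: "int fps \<Rightarrow> 'a::comm_ring_1 fps" where
  "fps_of_ints f = Abs_fps (\<lambda>n. of_int (f $ n))"

lemma fps_of_ints_nth [simp]: "fps_of_ints f $ n = of_int (f $ n)"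
  by (simp add: fps_of_ints_def)

lemma fps_of_ints_hom:
  "fps_of_ints 1 = 1" "fps_of_ints fps_X = fps_X"
  "fps_of_ints (numeral k) = numeral k"
  "fps_of_ints (f + g) = fps_of_ints f + fps_of_ints g"
  "fps_of_ints (f - g) = fps_of_ints f - fps_of_ints g"
  "fps_of_ints (f * g) = fps_of_ints f * fps_of_ints g"
  by (rule fps_ext, simp add: fps_mult_nth fps_X_def numeral_fps_const fps_const_def fps_one_def)+

lemma fps_of_ints_power: "fps_of_ints (f ^ n) = fps_of_ints f ^ n"
  by (induction n) (simp_all add: fps_of_ints_hom)

lemma fps_of_ints_prod: "fps_of_ints (\<Prod>i\<in>A. f i) = (\<Prod>i\<in>A. fps_of_ints (f i))"
  by (induction A rule: infinite_finite_induct) (simp_all add: fps_of_ints_hom)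

lemma fps_of_ints_qprod: "fps_of_ints (qprod m) = qprod m"
proof (rule fps_ext)
  fix n
  have "of_int ((\<Prod>i<n. 1 - fps_X ^ (m * Suc i) :: int fps) $ n) =
     fps_of_ints (\<Prod>i<n. 1 - fps_X ^ (m * Suc i)) $ n" by simp
  also have "fps_of_ints (\<Prod>i<n. 1 - fps_X ^ (m * Suc i)) = (\<Prod>i<n. 1 - fps_X ^
      (m * Suc i) :: 'a fps)"
    by (simp only: fps_of_ints_prod fps_of_ints_hom fps_of_ints_power)
  finally show "fps_of_ints (qprod m) $ n = (qprod m :: 'a fps) $ n"
    by (simp add: qprod_def fps_infprod_def)
qed

lemma fps_of_ints_theta_series:
  "fps_of_ints (theta_series c e) = theta_series (\<lambda>j. of_int (c j)) e"
  by (rule fps_ext) simp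

lemma fps_of_ints_compose:
  "d > 0 \<Longrightarrow> fps_of_ints (f oo fps_X ^ d) = fps_of_ints f oo fps_X ^ d"
  by (rule fps_ext) (simp add: fps_compose_X_power_nth)

lemma fps_of_ints_eq_iff:
  "(fps_of_ints f :: 'a::{comm_ring_1,ring_char_0} fps) = fps_of_ints g \<longleftrightarrow> f = g"
  by (simp add: fps_eq_iff)

lemma phi_decompose:
  "phi = ((phi oo fps_X ^ 3) oo fps_X ^ 3) - 2 * fps_X * (omega oo fps_X ^ 3 :: 'a::idom fps)"
proof -
  have "(- 2 * omega) oo fps_X ^ 3 = - 2 * (omega oo fps_X ^ 3 :: 'a fps)"
    by (rule fps_ext) (simp add: fps_compose_X_power_nth numeral_fps_const)
  then show ?thesis
    using section3_decompose[of "phi :: 'a fps"]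
    unfolding section3_phi_0 section3_phi_1 section3_phi_2 by (simp add: mult_ac)
qed

lemma fps_scale_compose_X_cubed:
  "w ^ 3 = 1 \<Longrightarrow> fps_scale w (f oo fps_X ^ 3) = (f oo fps_X ^ 3 :: 'a::idom fps)"
  by (rule fps_ext) (auto simp: fps_compose_X_power_nth power_mult)

lemma fps_compose_X_power_inject:
  assumes "d > 0" "f oo fps_X ^ d = (g oo fps_X ^ d :: 'a::comm_ring_1 fps)"
  shows "f = g"
proof (rule fps_ext)
  fix n
  have "(f oo fps_X ^ d) $ (d * n) = (g oo fps_X ^ d) $ (d * n)" using assms(2) by simp
  then show "f $ n = g $ n" using assms(1) by (simp add: fps_compose_X_power_nth)
qed

text \<open>The norm of \<open>phi\<close> is computed twice: from the dissection
  \<open>a - 2 * fps_X * b\<close> as a difference of cubes, and from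
  \<open>phi * qprod 2 = qprod 1 ^ 2\<close> by multiplicativity. Both results are series in
  \<open>fps_X ^ 3\<close>, and that substitution is undone at the end.\<close>

lemma norm_phi_complex:
  "((phi oo fps_X ^ 3) ^ 3 - 8 * fps_X * omega ^ 3) * qprod 2 ^ 4 * qprod 3 ^ 2 =
    (qprod 1 ^ 8 * qprod 6 :: complex fps)"
proof -
  define w where "w = Complex (-1/2) (sqrt 3 / 2)"
  have w: "w ^ 2 + w + 1 = 0"
    by (simp add: w_def complex_eq_iff power2_eq_square)
  have w3: "w ^ 3 = 1" using cube_root_power[OF w, of 3] by simp
  define a where "a = (phi oo fps_X ^ 3 :: complex fps) oo fps_X ^ 3"
  define b where "b = (omega oo fps_X ^ 3 :: complex fps)"
  have sc: "fps_scale v (phi :: complex fps) = a - 2 * fps_const v * fps_X * b" if "v ^ 3 = 1" for v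
  proof -
    have "fps_scale v (phi :: complex fps) = fps_scale v (a - 2 * fps_X * b)"
      unfolding a_def b_def using phi_decompose by metis
    also have "\<dots> = fps_scale v a - 2 * (fps_const v * fps_X) * fps_scale v b"
    proof -
      have "fps_scale v 2 = 2" "fps_scale v fps_X = fps_const v * fps_X"
        by (rule fps_ext, simp add: numeral_fps_const fps_X_def)+
      then show ?thesis
        unfolding fps_scale_mult[symmetric] by (simp add: fps_scale_def fps_compose_sub_distrib
            fps_compose_mult_distrib)
    qed
    finally show ?thesis
      unfolding a_def b_def fps_scale_compose_X_cubed[OF that] by (simp add: mult_ac)
  qed
  define W where "W = fps_const w"
  have W: "W ^ 2 + W + 1 = 0" using w
    by (simp add: W_def fps_const_power flip: fps_const_1_eq_1)
  have p1: "phi = a - 2 * fps_X * b" unfolding a_def b_def by (rule phi_decompose)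
  have p2: "fps_scale w phi = a - 2 * W * fps_X * b" using sc[OF w3] by (simp add: W_def)
  have p3: "fps_scale (w ^ 2) phi = a - 2 * W ^ 2 * fps_X * b"
  proof -
    have "(w ^ 2) ^ 3 = (w ^ 3) ^ 2" by (simp flip: power_mult)
    then show ?thesis using sc[of "w ^ 2"] w3 by (simp add: W_def fps_const_power)
  qed
  define y where "y = 2 * fps_X * b"
  have y: "phi = a - y" "fps_scale w phi = a - W * y" "fps_scale (w ^ 2) phi = a - W ^ 2 * y"
    unfolding p2 p3 y_def using p1 by (simp_all add: mult_ac)
  have "norm3 w phi = (a - y) * (a - W * y) * (a - W ^ 2 * y)"
    unfolding norm3_def y(2,3) by (subst y(1)) (rule refl)
  also have "\<dots> = a ^ 3 - y ^ 3" by (rule cube_minus_cube_factor[OF W])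
  also have "\<dots> = ((phi oo fps_X ^ 3) ^ 3 - 8 * fps_X * omega ^ 3) oo fps_X ^ 3"
  proof -
    have "(8 :: complex fps) oo fps_X ^ 3 = 8"
      by (rule fps_ext) (simp add: fps_compose_X_power_nth numeral_fps_const)
    then show ?thesis
      by (simp add: a_def b_def y_def fps_compose_sub_distrib fps_compose_mult_distrib
          fps_compose_power power_mult_distrib)
  qed
  finally have np: "norm3 w phi = \<dots>" .
  have phi1: "norm3 w phi * norm3 w (qprod 2) = norm3 w (qprod 1) ^ 2"
    unfolding norm3_mult[symmetric] phi_qprod power2_eq_square ..
  have q6: "norm3 w (qprod 2) * qprod 18 = qprod 6 ^ 4"
    and q3: "norm3 w (qprod 1) * qprod 9 = qprod 3 ^ 4"
    using norm3_qprod[OF w, of 2] norm3_qprod[OF w, of 1] by simp_all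
  have "norm3 w phi * qprod 6 ^ 4 * qprod 9 ^ 2 = (norm3 w phi * norm3 w
      (qprod 2)) * qprod 18 * qprod 9 ^ 2"
    unfolding q6[symmetric] by (simp only: mult_ac)
  also have "\<dots> = (norm3 w (qprod 1) * qprod 9) ^ 2 * qprod 18"
    unfolding phi1 power_mult_distrib by (simp only: mult_ac)
  also have "\<dots> = qprod 3 ^ 8 * qprod 18"
    unfolding q3 by (simp flip: power_mult)
  finally have "norm3 w phi * qprod 6 ^ 4 * qprod 9 ^ 2 = qprod 3 ^ 8 * qprod 18" .
  then have "(((phi oo fps_X ^ 3) ^ 3 - 8 * fps_X * omega ^ 3) * qprod 2 ^ 4 * qprod 3 ^ 2) oo fps_X
      ^ 3
      = (qprod 1 ^ 8 * qprod 6 :: complex fps) oo fps_X ^ 3"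
    unfolding np by (simp add: fps_compose_mult_distrib qprod_compose flip: fps_compose_power)
  then show ?thesis by (rule fps_compose_X_power_inject[rotated]) simp
qed

text \<open>The change of coefficients is injective in characteristic 0, so the complex identity
  descends to the integers.\<close>

lemma norm_phi:
  "((phi oo fps_X ^ 3) ^ 3 - 8 * fps_X * omega ^ 3) * qprod 2 ^ 4 * qprod 3 ^ 2 =
    (qprod 1 ^ 8 * qprod 6 :: int fps)"
proof -
  have "fps_of_ints phi = (phi :: complex fps)" "fps_of_ints omega = (omega :: complex fps)"
    unfolding phi_def omega_def fps_of_ints_theta_series by simp_all
  then have "fps_of_ints (((phi oo fps_X ^ 3) ^ 3 - 8 * fps_X * omega ^ 3) * qprod 2 ^ 4 * qprod 3 ^
      2) =
    (fps_of_ints (qprod 1 ^ 8 * qprod 6) :: complex fps)"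
    using norm_phi_complex
    by (simp add: fps_of_ints_hom fps_of_ints_power fps_of_ints_compose fps_of_ints_qprod)
  then show ?thesis unfolding fps_of_ints_eq_iff .
qed

lemma section3_X_power_mult_compose:
  assumes "r < 3" "s < 3"
  shows "section3 r (fps_X ^ s * (g oo fps_X ^ 3)) = (if r = s then g else 0)"
proof -
  have "section3 r (fps_X ^ s) = (if r = s then 1 else (0 :: 'a fps))"
    using assms by (intro fps_ext) (auto simp: fps_X_power_nth)
  then show ?thesis using section3_mult_compose[OF assms(1), of "fps_X ^ s" g] by simp
qed

text \<open>With \<open>phi = a - 2 X b\<close>, multiplying \<open>G phi = qprod 15\<close> by \<open>a\<^sup>2 + 2 X a b + 4 X\<^sup>2 b\<^sup>2\<close>
  makes the coefficient of \<open>G\<close> a series in \<open>X\<^sup>3\<close>, so that sections can be taken.\<close>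

lemma section3_2_quotient:
  fixes G :: "int fps"
  assumes "G * phi = qprod 15"
  shows "section3 2 G * qprod 1 ^ 6 = 4 * qprod 5 * qprod 2 ^ 2 * qprod 6 ^ 3"
proof -
  define P where "P = (phi oo fps_X ^ 3 :: int fps)"
  define a where "a = P oo fps_X ^ 3"
  define b where "b = (omega oo fps_X ^ 3 :: int fps)"
  define n where "n = P ^ 3 - 8 * fps_X * omega ^ 3"
  have p: "phi = a - 2 * fps_X * b" unfolding a_def b_def P_def by (rule phi_decompose)
  have num: "(numeral k :: int fps) oo fps_X ^ 3 = numeral k" for k
    by (rule fps_ext) (simp add: fps_compose_X_power_nth numeral_fps_const)
  have n: "n oo fps_X ^ 3 = a ^ 3 - 8 * fps_X ^ 3 * b ^ 3"
    by (simp add: n_def a_def b_def num fps_compose_sub_distrib fps_compose_mult_distrib flip: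
        fps_compose_power)
  have "G * (n oo fps_X ^ 3) = (G * phi) * (a ^ 2 + 2 * fps_X * a * b + 4 * fps_X ^ 2 * b ^ 2)"
    unfolding n p by (simp add: algebra_simps power2_eq_square power3_eq_cube)
  also have "\<dots> = (fps_X ^ 0 * (P ^ 2 oo fps_X ^ 3) + fps_X ^ 1 * ((2 * P * omega) oo fps_X ^ 3)
      + fps_X ^ 2 * ((4 * omega ^ 2) oo fps_X ^ 3)) * (qprod 5 oo fps_X ^ 3)"
    unfolding assms a_def b_def
    by (simp add: qprod_compose num fps_compose_mult_distrib mult_ac flip: fps_compose_power)
  finally have "section3 2 (G * (n oo fps_X ^ 3)) = section3 2 (\<dots>)" by simp
  then have "section3 2 G * n = section3 2 (fps_X ^ 0 * (P ^ 2 oo fps_X ^ 3) + fps_X ^ 1 *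
      ((2 * P * omega) oo fps_X ^ 3)
      + fps_X ^ 2 * ((4 * omega ^ 2) oo fps_X ^ 3)) * qprod 5"
    unfolding section3_mult_compose[of 2, simplified zero_less_numeral, simplified] by simp
  also have "section3 2 (fps_X ^ 0 * (P ^ 2 oo fps_X ^ 3) + fps_X ^ 1 *
      ((2 * P * omega) oo fps_X ^ 3)
      + fps_X ^ 2 * ((4 * omega ^ 2) oo fps_X ^ 3)) = 4 * omega ^ 2"
  proof -
    have "section3 2 (f + g) = section3 2 f + section3 2 g" for f g :: "int fps"
      by (rule fps_ext) simp
    then show ?thesis by (simp only: section3_X_power_mult_compose) simp
  qed
  finally have H: "section3 2 G * n = 4 * omega ^ 2 * qprod 5" .
  define H where "H = section3 2 G"
  \<comment> \<open>The nonzero factor \<open>qprod 1 ^ 2 * qprod 6\<close> completes the right side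
    of \<open>norm_phi\<close>, so that \<open>n\<close> can be brought in; it is cancelled at the
    end.\<close>
  have "(H * qprod 1 ^ 6) * (qprod 1 ^ 2 * qprod 6) = H * (qprod 1 ^ 8 * qprod 6)"
    by (simp add: mult_ac flip: power_add)
  also have "\<dots> = (H * n) * qprod 2 ^ 4 * qprod 3 ^ 2"
    using norm_phi unfolding n_def P_def by (simp add: mult_ac)
  also have "\<dots> = 4 * qprod 5 * qprod 2 ^ 2 * (omega * qprod 2 * qprod 3) ^ 2"
    unfolding H_def H by (simp add: power_mult_distrib mult_ac)
  also have "\<dots> = (4 * qprod 5 * qprod 2 ^ 2 * qprod 6 ^ 3) * (qprod 1 ^ 2 * qprod 6)"
    unfolding omega_qprod by algebra
  finally show ?thesis by (simp add: H_def)
qed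

section \<open>Generating functions of regular bipartitions\<close>

definition msets_of_sum :: "nat set \<Rightarrow> nat \<Rightarrow> nat multiset set" where
  "msets_of_sum S n = {M. set_mset M \<subseteq> S \<and> sum_mset M = n}"

definition partition_series :: "nat set \<Rightarrow> int fps" where
  "partition_series S = Abs_fps (\<lambda>n. int (card (msets_of_sum S n)))"

lemma finite_msets_of_sum:
  assumes "0 \<notin> S"
  shows "finite (msets_of_sum S n)"
proof (rule finite_subset[OF _ finite_positive_msets_sum_le[of n]])
  show "msets_of_sum S n \<subseteq> {M. (\<forall>p\<in>#M. p > 0) \<and> sum_mset M \<le> n}"
    using assms by (auto simp: msets_of_sum_def intro: gr0I)
qed

lemma msets_of_sum_insert:
  assumes "k \<notin> S"
  shows "msets_of_sum (insert k S) n =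
    msets_of_sum S n \<union> (if k \<le> n then add_mset k ` msets_of_sum (insert k S) (n - k) else {})"
proof (intro equalityI subsetI)
  fix M assume M: "M \<in> msets_of_sum (insert k S) n"
  show "M \<in> msets_of_sum S n \<union> (if k \<le> n then add_mset k ` msets_of_sum (insert k S)
      (n - k) else {})"
  proof (cases "k \<in># M")
    case True
    then obtain M' where M': "M = add_mset k M'" by (meson multi_member_split)
    with M have "k \<le> n" "M' \<in> msets_of_sum (insert k S) (n - k)"
      by (auto simp: msets_of_sum_def)
    then show ?thesis using M' by auto
  next
    case False
    then show ?thesis using M by (auto simp: msets_of_sum_def)
  qed
qed (auto simp: msets_of_sum_def split: if_splits)

text \<open>Removing one copy of \<open>k\<close> matches the partitions of \<open>n\<close>
  containing \<open>k\<close> with all partitions of \<open>n - k\<close> over the same set of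
  parts.\<close>

lemma partition_series_insert:
  assumes "k \<notin> S" "0 \<notin> insert k S"
  shows "partition_series (insert k S) * (1 - fps_X ^ k) = partition_series S"
proof (rule fps_ext)
  fix n
  let ?T = "msets_of_sum (insert k S)"
  have "card (?T n) = card (msets_of_sum S n) + (if k \<le> n then card (?T (n - k)) else 0)"
  proof (cases "k \<le> n")
    case True
    have "card (?T n) = card (msets_of_sum S n \<union> add_mset k ` ?T (n - k))"
      using msets_of_sum_insert[OF assms(1), of n] True by simp
    also have "\<dots> = card (msets_of_sum S n) + card (add_mset k ` ?T (n - k))"
    proof (rule card_Un_disjoint)
      show "finite (msets_of_sum S n)" "finite (add_mset k ` ?T (n - k))"
        using assms(2) by (simp_all add: finite_msets_of_sum)
      have "k \<notin># M" if "M \<in> msets_of_sum S n" for M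
        using that assms(1) by (auto simp: msets_of_sum_def)
      then show "msets_of_sum S n \<inter> add_mset k ` ?T (n - k) = {}" by fastforce
    qed
    also have "card (add_mset k ` ?T (n - k)) = card (?T (n - k))"
      by (rule card_image) (simp add: inj_on_def)
    finally show ?thesis using True by simp
  next
    case False
    then show ?thesis using msets_of_sum_insert[OF assms(1), of n] by simp
  qed
  then show "(partition_series (insert k S) * (1 - fps_X ^ k)) $ n = partition_series S $ n"
    by (simp add: partition_series_def right_diff_distrib fps_X_power_mult_right_nth)
qed

lemma partition_series_empty: "partition_series {} = 1"
proof (rule fps_ext)
  fix n
  have "msets_of_sum {} n = (if n = 0 then {{#}} else {})"
    by (auto simp: msets_of_sum_def)
  then show "partition_series {} $ n = 1 $ n" by (simp add: partition_series_def)
qed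

lemma partition_series_bounded:
  assumes "0 \<notin> S"
  shows "partition_series (S \<inter> {..n}) * (\<Prod>i<n. if Suc i \<in> S then 1 - fps_X ^ Suc i else 1) = 1"
proof (induction n)
  case 0
  have "S \<inter> {..0} = {}" using assms by auto
  then show ?case by (simp add: partition_series_empty)
next
  case (Suc n)
  let ?P = "\<Prod>i<n. if Suc i \<in> S then 1 - fps_X ^ Suc i else (1 :: int fps)"
  show ?case
  proof (cases "Suc n \<in> S")
    case True
    have "S \<inter> {..Suc n} = insert (Suc n) (S \<inter> {..n})" using True by (auto simp: le_Suc_eq)
    then have "partition_series (S \<inter> {..Suc n}) * (1 - fps_X ^ Suc n) = partition_series
        (S \<inter> {..n})"
      using partition_series_insert[of "Suc n" "S \<inter> {..n}"] assms by simp
    moreover have "partition_series (S \<inter> {..Suc n}) * (?P * (1 - fps_X ^ Suc n)) =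
        (partition_series (S \<inter> {..Suc n}) * (1 - fps_X ^ Suc n)) * ?P"
      by (simp only: mult_ac)
    ultimately have "partition_series (S \<inter> {..Suc n}) * (?P * (1 - fps_X ^ Suc n)) = 1"
      using Suc.IH by (simp only:)
    then show ?thesis using True by simp
  next
    case False
    then have "S \<inter> {..Suc n} = S \<inter> {..n}" by (auto simp: le_Suc_eq)
    then show ?thesis using False Suc.IH by simp
  qed
qed

lemma infprod_ok_subset: "infprod_ok (\<lambda>i. if Suc i \<in> S then 1 - fps_X ^ Suc i else
    (1 :: 'a::comm_ring_1 fps))"
  using infprod_ok_qprod[of 1, where 'a = 'a] by (simp add: infprod_ok_def)

text \<open>The coefficients up to \<open>n\<close> involve only parts up to \<open>n\<close>, so
  the finite product formula applies modulo \<open>fps_X ^ Suc n\<close>.\<close>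

theorem partition_series_infprod:
  assumes "0 \<notin> S"
  shows "partition_series S * fps_infprod (\<lambda>i. if Suc i \<in> S then 1 - fps_X ^ Suc i else 1) = 1"
  unfolding fps_eq_cong_iff
proof
  fix n
  have "fps_cong (Suc n) (partition_series S) (partition_series (S \<inter> {..n}))"
    unfolding fps_cong_def
  proof (intro allI impI)
    fix k assume k: "k < Suc n"
    have "p \<le> n" if "M \<in> msets_of_sum S k" "p \<in># M" for M p
    proof -
      have "p \<le> sum_mset M" using that(2) by (metis le_add1 multi_member_split sum_mset.add_mset)
      then show ?thesis using that(1) k by (simp add: msets_of_sum_def)
    qed
    then have "msets_of_sum S k = msets_of_sum (S \<inter> {..n}) k"
      by (auto simp: msets_of_sum_def)
    then show "partition_series S $ k = partition_series (S \<inter> {..n}) $ k"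
      by (simp add: partition_series_def)
  qed
  moreover have "fps_cong (Suc n) (fps_infprod (\<lambda>i. if Suc i \<in> S then 1 - fps_X ^ Suc i else 1))
      (\<Prod>i<n. if Suc i \<in> S then 1 - fps_X ^ Suc i else (1 :: int fps))"
    by (rule fps_infprod_cong[OF infprod_ok_subset order_refl])
  ultimately have "fps_cong (Suc n)
      (partition_series S * fps_infprod (\<lambda>i. if Suc i \<in> S then 1 - fps_X ^ Suc i else 1))
      (partition_series (S \<inter> {..n}) * (\<Prod>i<n. if Suc i \<in> S then 1 - fps_X ^ Suc i else 1))"
    by (rule fps_cong_mult)
  then have "fps_cong (Suc n)
      (partition_series S * fps_infprod (\<lambda>i. if Suc i \<in> S then 1 - fps_X ^ Suc i else 1)) 1"
    by (simp only: partition_series_bounded[OF assms])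
  then show "fps_cong n (partition_series S * fps_infprod
      (\<lambda>i. if Suc i \<in> S then 1 - fps_X ^ Suc i else 1)) 1"
    by (rule fps_cong_mono) simp
qed

text \<open>The factors of \<open>qprod 1\<close> at multiples of \<open>s\<close> form
  \<open>qprod s\<close>; those at the other indices are inverse to the partition series.\<close>

lemma regular_partition_series:
  assumes "s > 0"
  shows "partition_series {p. p > 0 \<and> \<not> s dvd p} * qprod 1 = qprod s"
proof -
  let ?S = "{p. p > 0 \<and> \<not> s dvd p}"
  let ?f = "\<lambda>i. if Suc i \<in> ?S then 1 - fps_X ^ Suc i else (1 :: int fps)"
  let ?g = "\<lambda>i. if Suc i \<in> {p. s dvd p} then 1 - fps_X ^ Suc i else (1 :: int fps)"
  have "qprod s = fps_infprod ?g"
    using fps_infprod_multiples[of "\<lambda>k. 1 - fps_X ^ k :: int fps" s] assms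
      infprod_ok_qprod[of 1, where 'a = int]
    unfolding qprod_def by simp
  moreover have "fps_infprod ?f * fps_infprod ?g = fps_infprod (\<lambda>i. ?f i * ?g i)"
    by (rule fps_infprod_mult[OF infprod_ok_subset infprod_ok_subset, symmetric])
  moreover have "(\<lambda>i. ?f i * ?g i) = (\<lambda>i. 1 - fps_X ^ (1 * Suc i))" by auto
  ultimately have f: "qprod 1 = fps_infprod ?f * qprod s" by (simp add: qprod_def)
  have "partition_series ?S * fps_infprod ?f = 1"
    by (rule partition_series_infprod) simp
  then show ?thesis unfolding f by (simp flip: mult.assoc)
qed

definition bipartition_series :: "nat \<Rightarrow> nat \<Rightarrow> int fps" where
  "bipartition_series s t = Abs_fps (\<lambda>n. int (B s t n))"

lemma bipartition_series_mult:
  "bipartition_series s t = partition_series {p. p > 0 \<and> \<not> s dvd p} * partition_series {p. p > 0 \<and> \<not>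
      t dvd p}"
proof (rule fps_ext)
  fix n
  let ?S = "\<lambda>s. {p :: nat. p > 0 \<and> \<not> s dvd p}"
  let ?A = "\<lambda>k. msets_of_sum (?S s) k \<times> msets_of_sum (?S t) (n - k)"
  have "regular_bipartitions s t n = (\<Union>k\<in>{0..n}. ?A k)"
    by (auto simp: regular_bipartitions_def regular_partition_def msets_of_sum_def)
  moreover have "card (\<Union>k\<in>{0..n}. ?A k) = (\<Sum>k\<in>{0..n}. card (?A k))"
    by (intro card_UN_disjoint ballI impI finite_cartesian_product finite_msets_of_sum)
       (auto simp: msets_of_sum_def)
  ultimately have "B s t n = (\<Sum>k=0..n. card (msets_of_sum (?S s) k) * card (msets_of_sum (?S t)
      (n - k)))"
    by (simp add: B_def card_cartesian_product)
  then show "bipartition_series s t $ n = (partition_series (?S s) * partition_series (?S t)) $ n"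
    by (simp add: bipartition_series_def partition_series_def fps_mult_nth)
qed

lemma bipartition_series_qprod:
  assumes "s > 0" "t > 0"
  shows "bipartition_series s t * qprod 1 ^ 2 = qprod s * qprod t"
  unfolding bipartition_series_mult regular_partition_series[OF assms(1), symmetric]
    regular_partition_series[OF assms(2), symmetric] power2_eq_square
  by (simp only: mult_ac)

section \<open>Reduction modulo 5\<close>

lemma numeral_dvd_fps_iff: "(numeral k :: int fps) dvd f \<longleftrightarrow> (\<forall>n. numeral k dvd f $ n)"
proof
  assume "(numeral k :: int fps) dvd f"
  then show "\<forall>n. numeral k dvd f $ n" by (auto simp: numeral_fps_const elim!: dvdE)
next
  assume *: "\<forall>n. numeral k dvd f $ n"
  have "f = numeral k * Abs_fps (\<lambda>n. f $ n div numeral k)"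
    using * by (intro fps_ext) (simp add: numeral_fps_const)
  then show "numeral k dvd f" by (metis dvd_triv_left)
qed

lemma dvd_prod_diff:
  fixes f g :: "'i \<Rightarrow> 'a::comm_ring_1"
  assumes "\<And>i. i \<in> A \<Longrightarrow> d dvd f i - g i"
  shows "d dvd (\<Prod>i\<in>A. f i) - (\<Prod>i\<in>A. g i)"
  using assms
proof (induction A rule: infinite_finite_induct)
  case (insert i A)
  have "f i * prod f A - g i * prod g A = f i * (prod f A - prod g A) + (f i - g i) * prod g A"
    by (simp add: algebra_simps)
  then show ?case using insert by (simp add: dvd_add dvd_mult dvd_mult2)
qed simp_all

text \<open>The Frobenius congruence between \<open>(1 - x) ^ 5\<close> and
  \<open>1 - x ^ 5\<close>, applied to each factor; the quotient by 5 is written out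
  explicitly.\<close>

lemma qprod_5_mod_5: "(5 :: int fps) dvd qprod 5 - qprod 1 ^ 5"
  unfolding numeral_dvd_fps_iff
proof
  fix n
  have ok: "infprod_ok (\<lambda>i. 1 - fps_X ^ (1 * Suc i) :: int fps)"
    by (rule infprod_ok_qprod) simp
  have "(5 :: int fps) dvd (1 - fps_X ^ (5 * Suc i)) - (1 - fps_X ^ (1 * Suc i)) ^ 5" for i
  proof -
    define x where "x = (fps_X :: int fps) ^ (1 * Suc i)"
    have "(fps_X :: int fps) ^ (5 * Suc i) = x ^ 5"
      unfolding x_def power_mult[symmetric] by (simp only: mult_1 mult.commute)
    moreover have "(1 - x ^ 5) - (1 - x) ^ 5 = 5 * (x - 2 * x ^ 2 + 2 * x ^ 3 - x ^ 4)"
      by (simp add: eval_nat_numeral algebra_simps)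
    ultimately show ?thesis unfolding x_def[symmetric] by (simp only: dvd_triv_left)
  qed
  then have "(5 :: int fps) dvd (\<Prod>i<n. 1 - fps_X ^ (5 * Suc i)) - (\<Prod>i<n. (1 - fps_X ^
      (1 * Suc i)) ^ 5)"
    by (rule dvd_prod_diff)
  then have "5 dvd ((\<Prod>i<n. 1 - fps_X ^ (5 * Suc i)) - (\<Prod>i<n. (1 - fps_X ^
      (1 * Suc i)) ^ 5) :: int fps) $ n"
    unfolding numeral_dvd_fps_iff by blast
  then show "5 dvd (qprod 5 - qprod 1 ^ 5 :: int fps) $ n"
    unfolding qprod_def fps_infprod_power[OF ok, symmetric] by
        (simp only: fps_infprod_def fps_sub_nth fps_nth_Abs_fps)
qed

lemma section3_bipartition_series_mod_5:
  "(5 :: int fps) dvd section3 2 (bipartition_series 2 15) - 4 * (psi * qprod 6 ^ 3)"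
proof -
  define H where "H = section3 2 (bipartition_series 2 15)"
  have "(bipartition_series 2 15 * phi) * qprod 2 = bipartition_series 2 15 * (phi * qprod 2)"
    by (simp only: mult.assoc)
  also have "\<dots> = qprod 15 * qprod 2"
    unfolding phi_qprod using bipartition_series_qprod[of 2 15] by (simp add: mult.commute)
  finally have "bipartition_series 2 15 * phi = qprod 15" by simp
  then have "H * qprod 1 ^ 6 = 4 * qprod 5 * (psi * qprod 1) * qprod 6 ^ 3"
    unfolding psi_qprod H_def by (rule section3_2_quotient)
  moreover have "qprod 1 ^ 6 = qprod 1 ^ 5 * (qprod 1 :: int fps)"
    using power_Suc2[of "qprod 1 :: int fps" 5] by simp
  ultimately have "(H * qprod 1 ^ 5) * qprod 1 = (4 * qprod 5 * psi * qprod 6 ^ 3) * qprod 1"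
    by (simp only: mult_ac)
  then have "H * qprod 1 ^ 5 = 4 * qprod 5 * psi * qprod 6 ^ 3" by simp
  then have E: "qprod 1 ^ 5 * (H - 4 * (psi * qprod 6 ^ 3)) = (qprod 5 - qprod 1 ^ 5) * (4 *
      (psi * qprod 6 ^ 3))"
    by (simp add: algebra_simps)
  have 1: "(5 :: int fps) dvd qprod 1 ^ 5 * (H - 4 * (psi * qprod 6 ^ 3))"
    unfolding E using qprod_5_mod_5 by (rule dvd_mult2)
  \<comment> \<open>The series \<open>qprod 1\<close> is a unit over the integers, so its fifth
    power can be removed from the divisibility.\<close>
  obtain g :: "int fps" where g: "qprod 1 * g = 1"
    using fps_unit_exists_inverse[of "qprod 1 :: int fps"] by auto
  have "H - 4 * (psi * qprod 6 ^ 3) = (qprod 1 * g) ^ 5 * (H - 4 * (psi * qprod 6 ^ 3))"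
    unfolding g by simp
  also have "\<dots> = g ^ 5 * (qprod 1 ^ 5 * (H - 4 * (psi * qprod 6 ^ 3)))"
    by (simp only: power_mult_distrib mult_ac)
  finally show ?thesis unfolding H_def[symmetric] using 1 by (metis dvd_mult)
qed

theorem theorem3p1:
  fixes n :: nat
  shows "[B 2 15 (9 * n + 8) = 0] (mod 5) \<and>
         [B 2 15 (27 * n + 14) = 0] (mod 5) \<and>
         [B 2 15 (27 * n + 23) = 2 * B 2 15 (3 * n + 2)] (mod 5)"
proof -
  define U where "U = (psi * qprod 6 ^ 3 :: int fps)"
  have B_mod: "5 dvd int (B 2 15 (3 * k + 2)) - 4 * U $ k" for k
    using section3_bipartition_series_mod_5
    unfolding U_def[symmetric] numeral_dvd_fps_iff by
        (simp add: bipartition_series_def numeral_fps_const)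
  \<comment> \<open>Since this cube is a series in \<open>fps_X ^ 3\<close>, sections of
    \<open>U\<close> are determined by those of \<open>psi\<close>.\<close>
  have q6: "qprod 6 ^ 3 = (qprod 2 ^ 3 oo fps_X ^ 3 :: int fps)"
    by (simp add: qprod_compose flip: fps_compose_power)
  have U: "section3 r U = section3 r psi * qprod 2 ^ 3" if "r < 3" for r
    unfolding U_def q6 using that by (rule section3_mult_compose)
  have U1: "section3 1 U = qprod 2 ^ 3 * (psi oo fps_X ^ 3)"
    using U[of 1] by (simp only: section3_psi_1 mult.commute)
  have U2: "section3 2 U = 0"
    using U[of 2] by (simp add: section3_psi_2)
  have U11: "section3 1 (section3 1 U) = 0"
    unfolding U1 by (subst section3_mult_compose)
        (simp_all add: section3_qprod_2_cube_1[simplified])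
  have U12: "section3 2 (section3 1 U) = - 3 * U"
    unfolding U1 by (subst section3_mult_compose)
        (simp_all add: section3_qprod_2_cube_2 U_def mult_ac)
  have "U $ (3 * n + 2) = 0"
    using U2 by (metis fps_zero_nth section3_nth)
  then have 1: "5 dvd int (B 2 15 (9 * n + 8))"
    using B_mod[of "3 * n + 2"] by (simp add: algebra_simps)
  \<comment> \<open>The index is \<open>9 * n + 4\<close>, and
    \<open>3 * (9 * n + 4) + 2 = 27 * n + 14\<close>.\<close>
  have "U $ (3 * (3 * n + 1) + 1) = 0"
    using U11 by (metis fps_zero_nth section3_nth)
  then have 2: "5 dvd int (B 2 15 (27 * n + 14))"
    using B_mod[of "3 * (3 * n + 1) + 1"] by (simp add: algebra_simps)
  have "U $ (3 * (3 * n + 2) + 1) = (- 3 * U) $ n"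
    using U12 by (metis section3_nth)
  then have "U $ (9 * n + 7) = - 3 * U $ n"
    by (simp add: numeral_fps_const algebra_simps)
  \<comment> \<open>Here \<open>3 * (9 * n + 7) + 2 = 27 * n + 23\<close>, and the factor
    \<open>- 3\<close> is 2 modulo 5.\<close>
  then have 3: "5 dvd int (B 2 15 (27 * n + 23)) - 2 * int (B 2 15 (3 * n + 2))"
    using B_mod[of "9 * n + 7"] B_mod[of n] by (simp add: algebra_simps) presburger
  have "[int (B 2 15 (9 * n + 8)) = int 0] (mod int 5)"
    "[int (B 2 15 (27 * n + 14)) = int 0] (mod int 5)"
    "[int (B 2 15 (27 * n + 23)) = int (2 * B 2 15 (3 * n + 2))] (mod int 5)"
    using 1 2 3 by (simp_all add: cong_iff_dvd_diff)
  then show ?thesis unfolding cong_int_iff by blast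
qed

end
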